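(* Let $\mathcal{G}=(\mathbf{A},\mathbf{B},\mathbf{C},\mathbf{D})$ be a minimal, asymptotically stable linear system with $\mathbf{A}\in\mathbb{R}^{n\times n}$, $\mathbf{B}\in\mathbb{R}^{n\times m}$, $\mathbf{C}\in\mathbb{R}^{p\times n}$, $\mathbf{D}\in\mathbb{R}^{p\times m}$ and transfer function $\mathbf{G}(s)=\mathbf{C}(s\mathbf{I}_n-\mathbf{A})^{-1}\mathbf{B}+\mathbf{D}$. Assume $\mathcal{G}$ is strictly bounded-real, i.e. $\mathbf{I}_m-\mathbf{G}(-\dot{\imath}\omega)^{\mathsf T}\mathbf{G}(\dot{\imath}\omega)\succ\mathbf{0}$ for all $\omega\in\mathbb{R}$, and that $\mathbf{R}_{\mathcal J}:=\mathbf{I}_m-\mathbf{D}^{\mathsf T}\mathbf{D}\succ\mathbf{0}$ and $\mathbf{R}_{\mathcal K}:=\mathbf{I}_p-\mathbf{D}\mathbf{D}^{\mathsf T}\succ\mathbf{0}$. Let $\mathbf{Q}_{\mathcal J}^{-},\mathbf{P}_{\mathcal K}^{-}\in\mathbb{R}^{n\times n}$ be the minimal solutions of the algebraic Riccati equations $$\mathbf{A}^{\mathsf T}\mathbf{Q}_{\mathcal J}+\mathbf{Q}_{\mathcal J}\mathbf{A}+\mathbf{C}^{\mathsf T}\mathbf{C}+(\mathbf{B}^{\mathsf T}\mathbf{Q}_{\mathcal J}+\mathbf{D}^{\mathsf T}\mathbf{C})^{\mathsf T}(\mathbf{I}_m-\mathbf{D}^{\mathsf T}\mathbf{D})^{-1}(\mathbf{B}^{\mathsf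 T}\mathbf{Q}_{\mathcal J}+\mathbf{D}^{\mathsf T}\mathbf{C})=\mathbf{0},$$ $$\mathbf{A}\mathbf{P}_{\mathcal K}+\mathbf{P}_{\mathcal K}\mathbf{A}^{\mathsf T}+\mathbf{B}\mathbf{B}^{\mathsf T}+(\mathbf{P}_{\mathcal K}\mathbf{C}^{\mathsf T}+\mathbf{B}\mathbf{D}^{\mathsf T})(\mathbf{I}_p-\mathbf{D}\mathbf{D}^{\mathsf T})^{-1}(\mathbf{P}_{\mathcal K}\mathbf{C}^{\mathsf T}+\mathbf{B}\mathbf{D}^{\mathsf T})^{\mathsf T}=\mathbf{0},$$ respectively. Set $$\mathbf{C}_{\mathcal J}:=-\mathbf{R}_{\mathcal J}^{-1/2}(\mathbf{B}^{\mathsf T}\mathbf{Q}_{\mathcal J}^{-}+\mathbf{D}^{\mathsf T}\mathbf{C}),\qquad \mathbf{J}(s):=\mathbf{C}_{\mathcal J}(s\mathbf{I}_n-\mathbf{A})^{-1}\mathbf{B}+\mathbf{R}_{\mathcal J}^{1/2},$$ $$\mathbf{B}_{\mathcal K}:=-(\mathbf{P}_{\mathcal K}^{-}\mathbf{C}^{\mathsf T}+\mathbf{B}\mathbf{D}^{\mathsf T})\mathbf{R}_{\mathcal K}^{-1/2},\qquad \mathbf{K}(s):=\mathbf{C}(s\mathbf{I}_n-\mathbf{A})^{-1}\mathbf{B}_{\mathcal K}+\mathbf{R}_{\mathcal K}^{1/2},$$ $$\widehat{\mathbf{C}}_{\mathcal J}:=\begin{bmatrix}\mathbf{C}\\ \mathbf{C}_{\mathcal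 J}\end{bmatrix}\in\mathbb{R}^{(p+m)\times n},\quad \widehat{\mathbf{B}}_{\mathcal K}:=\begin{bmatrix}\mathbf{B}&\mathbf{B}_{\mathcal K}\end{bmatrix}\in\mathbb{R}^{n\times(m+p)},\quad \widehat{\mathbf{J}}(s):=\begin{bmatrix}\mathbf{G}(s)\\ \mathbf{J}(s)\end{bmatrix},\quad \widehat{\mathbf{K}}(s):=\begin{bmatrix}\mathbf{G}(s)&\mathbf{K}(s)\end{bmatrix}.$$ With the choices $\mathbf{B}_{\mathcal X}=\widehat{\mathbf{B}}_{\mathcal K}$ and $\mathbf{C}_{\mathcal Y}=\widehat{\mathbf{C}}_{\mathcal J}$, define $$\mathbf{G}_{\sigma,\mathbf{A}}(s)=\mathbf{C}_{\mathcal Y}(s\mathbf{I}_n-\mathbf{A})^{-1}\mathbf{B}_{\mathcal X},\quad \mathbf{G}_{\mathbf{B}}(s)=\mathbf{C}_{\mathcal Y}(s\mathbf{I}_n-\mathbf{A})^{-1}\mathbf{B},\quad \mathbf{G}_{\mathbf{C}}(s)=\mathbf{C}(s\mathbf{I}_n-\mathbf{A})^{-1}\mathbf{B}_{\mathcal X}.$$ Then $$\mathbf{G}_{\sigma,\mathbf{A}}(s)=\left[\begin{bmatrix}\mathbf{I}_p&\mathbf{0}_{p\times m}\\ \mathbf{G}_\infty(-s)^{\mathsf T}&\mathbf{J}(-s)^{\mathsf T}\end{bmatrix}^{-1}\begin{bmatrix}\mathbf{G}_\infty(s)&\mathbf{K}_\infty(s)\\ -\mathbf{D}^{\mathsf T}\mathbf{G}_\infty(s)&-\mathbf{D}^{\mathsf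 T}\mathbf{K}_\infty(s)\end{bmatrix}\right]_+,$$ $$\mathbf{G}_{\mathbf{B}}(s)=\widehat{\mathbf{J}}_\infty(s),\qquad \mathbf{G}_{\mathbf{C}}(s)=\widehat{\mathbf{K}}_\infty(s).$$
   Context: A quadruple $(\mathbf{A},\mathbf{B},\mathbf{C},\mathbf{D})$ denotes the system $\dot{\mathbf x}=\mathbf{A}\mathbf{x}+\mathbf{B}\mathbf{u}$, $\mathbf{y}=\mathbf{C}\mathbf{x}+\mathbf{D}\mathbf{u}$; it is asymptotically stable if $\mathbf{A}$ is Hurwitz (all eigenvalues in the open left half-plane), and minimal if it is reachable and observable. $\dot{\imath}$ is the imaginary unit; $\succ,\succeq$ is the Loewner order. For a proper rational matrix function $\mathbf{F}(s)$, $\mathbf{F}_\infty(s):=\mathbf{F}(s)-\lim_{z\to\infty}\mathbf{F}(z)$ is its strictly proper part. For a strictly proper rational matrix function $\mathbf{F}$, $[\mathbf{F}(s)]_+$ denotes its purely stable part: the strictly proper summand with all poles in the open left half-plane in the (unique) decomposition of $\mathbf{F}$ into such a summand plus a strictly proper summand with no poles in the open left half-plane. The minimal solution of each Riccati equation is the symmetric positive definite solution that is $\preceq$ every symmetric solution of that equation; it is the stabilizing solution, meaning that $\mathbf{A}+\mathbf{B}\mathbf{R}_{\mathcal J}^{-1}(\mathbf{B}^{\mathsf T}\mathbf{Q}_{\mathcal J}^{-}+\mathbf{D}^{\mathsf T}\mathbf{C})$, respectively $\mathbf{A}+(\mathbf{P}_{\mathcal K}^{-}\mathbf{C}^{\mathsf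 T}+\mathbf{B}\mathbf{D}^{\mathsf T})\mathbf{R}_{\mathcal K}^{-1}\mathbf{C}$, is Hurwitz. The powers $\mathbf{R}_{\mathcal J}^{\pm1/2},\mathbf{R}_{\mathcal K}^{\pm1/2}$ are the symmetric positive definite ones. $\mathbf{J}$ and $\mathbf{K}$ are minimum phase spectral factors: $\mathbf{I}_m-\mathbf{G}(-s)^{\mathsf T}\mathbf{G}(s)=\mathbf{J}(-s)^{\mathsf T}\mathbf{J}(s)$ and $\mathbf{I}_p-\mathbf{G}(s)\mathbf{G}(-s)^{\mathsf T}=\mathbf{K}(s)\mathbf{K}(-s)^{\mathsf T}$. *)

theory Defs
  imports "HOL-Analysis.Analysis" "HOL-Complex_Analysis.Complex_Singularities"
begin

definition pos_def :: "real^'n^'n \<Rightarrow> bool"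
  where "pos_def M \<longleftrightarrow> transpose M = M \<and> (\<forall>x. x \<noteq> 0 \<longrightarrow> 0 < x \<bullet> (M *v x))"

definition loewner_le :: "real^'n^'n \<Rightarrow> real^'n^'n \<Rightarrow> bool"
  where "loewner_le M N \<longleftrightarrow> transpose (N - M) = N - M \<and> (\<forall>x. 0 \<le> x \<bullet> ((N - M) *v x))"

text \<open>On complex vectors \<open>\<bullet>\<close> is the real inner product, so \<open>x \<bullet> (M *v x)\<close> is the real part
  of \<open>x\<^sup>* M x\<close>, which is all of it when \<open>M\<close> is Hermitian.\<close>

definition herm_pos_def :: "complex^'n^'n \<Rightarrow> bool"
  where "herm_pos_def M \<longleftrightarrow>
    map_matrix cnj (transpose M) = M \<and> (\<forall>x. x \<noteq> 0 \<longrightarrow> 0 < x \<bullet> (M *v x))"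

abbreviation cmat :: "real^'n^'m \<Rightarrow> complex^'n^'m"
  where "cmat \<equiv> map_matrix complex_of_real"

definition vcat :: "'a^'n^'p \<Rightarrow> 'a^'n^'m \<Rightarrow> 'a^'n^('p + 'm)"
  where "vcat M N = (\<chi> i. case i of Inl k \<Rightarrow> M $ k | Inr k \<Rightarrow> N $ k)"

definition hcat :: "'a^'m^'n \<Rightarrow> 'a^'p^'n \<Rightarrow> 'a^('m + 'p)^'n"
  where "hcat M N = (\<chi> i j. case j of Inl k \<Rightarrow> M $ i $ k | Inr k \<Rightarrow> N $ i $ k)"


definition hurwitz :: "real^'n^'n \<Rightarrow> bool"
  where "hurwitz A \<longleftrightarrow> (\<forall>\<mu> v. v \<noteq> 0 \<and> cmat A *v v = \<mu> *s v \<longrightarrow> Re \<mu> < 0)"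

definition reachable :: "real^'n^'n \<Rightarrow> real^'m^'n \<Rightarrow> bool"
  where "reachable A B \<longleftrightarrow>
    (\<forall>x1. \<exists>T>0. \<exists>u x. continuous_on {0..T} u \<and>
       (\<forall>t\<in>{0..T}. (x has_vector_derivative (A *v x t + B *v u t)) (at t within {0..T})) \<and>
       x 0 = 0 \<and> x T = x1)"

text \<open>The zero input is used here: by linearity, two initial states give the same output for
  some input iff the output for the zero input and their difference as initial state is zero.\<close>

definition observable :: "real^'n^'n \<Rightarrow> real^'n^'p \<Rightarrow> bool"
  where "observable A C \<longleftrightarrow>
    (\<forall>x. (\<forall>t\<in>{0..}. (x has_vector_derivative (A *v x t)) (at t within {0..}) \<and> C *v x t = 0)
       \<longrightarrow> x 0 = 0)"

definition minimal_system :: "real^'n^'n \<Rightarrow> real^'m^'n \<Rightarrow> real^'n^'p \<Rightarrow> bool"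
  where "minimal_system A B C \<longleftrightarrow> reachable A B \<and> observable A C"

definition resolvent :: "real^'n^'n \<Rightarrow> complex \<Rightarrow> complex^'n^'n"
  where "resolvent A s = matrix_inv (mat s - cmat A)"

definition transfer ::
  "real^'n^'n \<Rightarrow> real^'m^'n \<Rightarrow> real^'n^'p \<Rightarrow> real^'m^'p \<Rightarrow> complex \<Rightarrow> complex^'m^'p"
  where "transfer A B C D s = cmat C ** resolvent A s ** cmat B + cmat D"


definition riccati_J ::
  "real^'n^'n \<Rightarrow> real^'m^'n \<Rightarrow> real^'n^'p \<Rightarrow> real^'m^'p \<Rightarrow> real^'n^'n \<Rightarrow> bool"
  where "riccati_J A B C D Q \<longleftrightarrow>
    transpose A ** Q + Q ** A + transpose C ** C
    + transpose (transpose B ** Q + transpose D ** C)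
      ** matrix_inv (mat 1 - transpose D ** D)
      ** (transpose B ** Q + transpose D ** C) = 0"

definition riccati_K ::
  "real^'n^'n \<Rightarrow> real^'m^'n \<Rightarrow> real^'n^'p \<Rightarrow> real^'m^'p \<Rightarrow> real^'n^'n \<Rightarrow> bool"
  where "riccati_K A B C D P \<longleftrightarrow>
    A ** P + P ** transpose A + B ** transpose B
    + (P ** transpose C + B ** transpose D)
      ** matrix_inv (mat 1 - D ** transpose D)
      ** transpose (P ** transpose C + B ** transpose D) = 0"

definition minimal_solution :: "(real^'n^'n \<Rightarrow> bool) \<Rightarrow> real^'n^'n \<Rightarrow> bool"
  where "minimal_solution eqn X \<longleftrightarrow>
    pos_def X \<and> eqn X \<and> (\<forall>Y. transpose Y = Y \<and> eqn Y \<longrightarrow> loewner_le X Y)"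


text \<open>A rational matrix function is represented by a total function on \<open>\<complex>\<close> that agrees with
  quotients of polynomials off finitely many points. The values at these points are irrelevant,
  and \<^const>\<open>is_pole\<close> and limits at infinity do not see them. For a rational matrix function,
  \<^const>\<open>is_pole\<close> (the norm tends to infinity) holds iff some entry has a pole.\<close>

definition rational_matrix :: "(complex \<Rightarrow> complex^'m^'p) \<Rightarrow> bool"
  where "rational_matrix F \<longleftrightarrow>
    (\<forall>i j. \<exists>a b. b \<noteq> 0 \<and> (\<forall>s. poly b s \<noteq> 0 \<longrightarrow> F s $ i $ j = poly a s / poly b s))"

definition strictly_proper :: "(complex \<Rightarrow> complex^'m^'p) \<Rightarrow> bool"
  where "strictly_proper F \<longleftrightarrow> rational_matrix F \<and> (F \<longlongrightarrow> 0) at_infinity"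

definition strictly_proper_part :: "(complex \<Rightarrow> complex^'m^'p) \<Rightarrow> complex \<Rightarrow> complex^'m^'p"
  where "strictly_proper_part F s = F s - Lim at_infinity F"

definition stable_decomposition ::
  "(complex \<Rightarrow> complex^'m^'p) \<Rightarrow> (complex \<Rightarrow> complex^'m^'p) \<Rightarrow> (complex \<Rightarrow> complex^'m^'p) \<Rightarrow> bool"
  where "stable_decomposition F H E \<longleftrightarrow>
    strictly_proper H \<and> (\<forall>z. is_pole H z \<longrightarrow> Re z < 0) \<and>
    strictly_proper E \<and> (\<forall>z. is_pole E z \<longrightarrow> \<not> Re z < 0) \<and>
    finite {s. F s \<noteq> H s + E s}"

text \<open>The summand \<open>H\<close> is unique as a rational function. The last two conditions fix its values
  (continuous away from the poles, 0 at the poles), so that it is unique as a function on \<open>\<complex>\<close>.\<close>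

definition stable_part :: "(complex \<Rightarrow> complex^'m^'p) \<Rightarrow> complex \<Rightarrow> complex^'m^'p"
  where "stable_part F =
    (THE H. (\<exists>E. stable_decomposition F H E) \<and>
       (\<forall>z. \<not> is_pole H z \<longrightarrow> isCont H z) \<and> (\<forall>z. is_pole H z \<longrightarrow> H z = 0))"

end

theory Submission
  imports Defs
    "HOL-Computational_Algebra.Field_as_Ring"
    "HOL-Computational_Algebra.Polynomial_Factorial"
    "HOL-Computational_Algebra.Fundamental_Theorem_Algebra"
begin

text \<open>Write \<open>\<Phi>(s) = (s - A)\<^sup>-\<^sup>1\<close>, \<open>X = C \<Phi> B\<^sub>X = [G\<^sub>\<infinity> K\<^sub>\<infinity>]\<close> and \<open>F = R\<^sup>-\<^sup>1 B\<^sup>T\<close> with \<open>R = R\<^sub>J\<^sup>1\<^sup>/\<^sup>2\<close>. The formulas for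
  \<open>G\<^sub>B\<close> and \<open>G\<^sub>C\<close> only say that removing the limit at infinity of a transfer function removes its
  feedthrough.

  For \<open>G\<^sub>\<sigma>\<^sub>,\<^sub>A\<close>, forward substitution in the block triangular system shows that the bracketed
  function has upper block \<open>X\<close> and lower block \<open>- J(-s)\<^sup>-\<^sup>T G(-s)\<^sup>T X\<close>. The latter is a product of
  functions with poles on both sides of the imaginary axis. The Riccati equation performs its
  partial fraction decomposition: it gives

  \<open>- J(-s)\<^sup>-\<^sup>T G(-s)\<^sup>T C \<Phi>(s) = C\<^sub>J \<Phi>(s) + F (s + N)\<^sup>-\<^sup>1 Q\<close>,

  where \<open>N\<^sup>T = A - F\<^sup>T C\<^sub>J\<close> is the closed-loop matrix (\<open>lower_block_identity\<close>,
  \<open>factorization_residue\<close>). Hence the bracketed function is \<open>G\<^sub>\<sigma>\<^sub>,\<^sub>A\<close> plus a strictly proper function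
  whose poles are among the negatives of the eigenvalues of \<open>N\<close>. The poles of \<open>G\<^sub>\<sigma>\<^sub>,\<^sub>A\<close> are eigenvalues
  of \<open>A\<close>, so they lie in the open left half-plane, and such a decomposition is unique
  (\<open>stable_decomposition_unique\<close>, by Liouville's theorem for rational functions).

  It remains that \<open>N\<close> has no eigenvalue with positive real part
  (\<open>minimal_riccati_solution_closed_loop\<close>). This is where minimality of \<open>Q\<close> enters. For symmetric \<open>W\<close>,
  \<open>Q - W\<close> solves the Riccati equation iff \<open>N W + W N\<^sup>T = (F W)\<^sup>T (F W)\<close>. From an eigenvector of \<open>N\<close> for
  an eigenvalue \<open>\<sigma> + i\<tau>\<close> with \<open>\<sigma> > 0\<close> one gets an explicit solution \<open>W\<close> of rank one or two that is
  positive semidefinite and not 0 (\<open>antistable_left_eigenvector_imp_difference\<close>), so that \<open>Q - W\<close> is not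
  above \<open>Q\<close>.\<close>

section \<open>Rational functions and the stable part\<close>

definition rational_fun :: "(complex \<Rightarrow> complex) \<Rightarrow> bool"
  where "rational_fun f \<longleftrightarrow> (\<exists>a b. b \<noteq> 0 \<and> (\<forall>s. poly b s \<noteq> 0 \<longrightarrow> f s = poly a s / poly b s))"

lemma rational_matrix_entries:
  "rational_matrix F \<longleftrightarrow> (\<forall>i j. rational_fun (\<lambda>s. F s $ i $ j))"
  by (simp add: rational_matrix_def rational_fun_def)

lemma rational_fun_diff:
  assumes "rational_fun f" "rational_fun g"
  shows "rational_fun (\<lambda>s. f s - g s)"
proof -
  obtain a b where f: "b \<noteq> 0" "\<And>s. poly b s \<noteq> 0 \<Longrightarrow> f s = poly a s / poly b s"
    using assms(1) unfolding rational_fun_def by blast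
  obtain c d where g: "d \<noteq> 0" "\<And>s. poly d s \<noteq> 0 \<Longrightarrow> g s = poly c s / poly d s"
    using assms(2) unfolding rational_fun_def by blast
  show ?thesis
    unfolding rational_fun_def
  proof (intro exI conjI allI impI)
    show "b * d \<noteq> 0" using f(1) g(1) by simp
    fix s assume "poly (b * d) s \<noteq> 0"
    then have nz: "poly b s \<noteq> 0" "poly d s \<noteq> 0" by auto
    show "f s - g s = poly (a * d - c * b) s / poly (b * d) s"
      unfolding f(2)[OF nz(1)] g(2)[OF nz(2)] diff_frac_eq[OF nz] by simp
  qed
qed

lemma eventually_off_finite:
  fixes z :: complex
  assumes "finite {s. \<not> P s}"
  shows "eventually P (at z)"
  using islimpt_finite[OF assms, of z] by (simp add: islimpt_iff_eventually)

lemma eventually_at_infinity_off_finite: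
  assumes "finite {s::complex. \<not> P s}"
  shows "eventually P at_infinity"
proof -
  obtain r where "\<forall>s\<in>{s. \<not> P s}. norm s < r"
    using finite_imp_bounded[OF assms] unfolding bounded_pos_less by blast
  then have "P s" if "r \<le> norm s" for s
    using that by force
  then show ?thesis unfolding eventually_at_infinity by blast
qed

text \<open>In lowest terms the roots of the denominator are exactly the poles; this is what ties the
  algebraic notion of a rational function to the analytic predicate \<open>is_pole\<close>. Cancelling a
  common factor can change the set of points at which the quotient represents the function, so
  agreement is only asked for off a finite set.\<close>

lemma rational_fun_lowest_terms:
  assumes "rational_fun f"
  obtains a b where "b \<noteq> 0" "coprime a b" "finite {s. f s \<noteq> poly a s / poly b s}"
proof -
  obtain a b where f: "b \<noteq> 0" "\<And>s. poly b s \<noteq> 0 \<Longrightarrow> f s = poly a s / poly b s"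
    using assms unfolding rational_fun_def by blast
  obtain a' b' where ab: "a = a' * gcd a b" "b = b' * gcd a b" "coprime a' b'"
    using gcd_coprime_exists[of a b] f(1) by (metis gcd_eq_0_iff)
  have "f s = poly a' s / poly b' s" if "poly b s \<noteq> 0" for s
  proof -
    have "poly a s = poly a' s * poly (gcd a b) s" "poly b s = poly b' s * poly (gcd a b) s"
      using ab(1,2)[THEN arg_cong, of "\<lambda>p. poly p s"] by (simp_all only: poly_mult)
    then show ?thesis using f(2)[OF that] that by simp
  qed
  then have "{s. f s \<noteq> poly a' s / poly b' s} \<subseteq> {s. poly b s = 0}" by auto
  then have "finite {s. f s \<noteq> poly a' s / poly b' s}"
    using poly_roots_finite[OF f(1)] finite_subset by blast
  moreover have "b' \<noteq> 0" using ab(2) f(1) by (metis mult_zero_left)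
  ultimately show ?thesis using that ab(3) by blast
qed

lemma quotient_pole:
  fixes a b :: "complex poly"
  assumes "b \<noteq> 0" "coprime a b" "poly b z = 0" "finite {s. f s \<noteq> poly a s / poly b s}"
  shows "is_pole f z"
proof -
  have "poly a z \<noteq> 0"
    using coprime_poly_0[OF assms(2)] assms(3) by blast
  moreover have "eventually (\<lambda>s. poly b s \<noteq> 0) (at z)"
    using eventually_off_finite poly_roots_finite[OF assms(1)] by auto
  then have "filterlim (poly b) (at 0) (at z)"
    using assms(3) isCont_tendsto_compose[OF poly_isCont[where p=b and x=z] tendsto_ident_at] unfolding filterlim_at isCont_def by auto
  moreover have "(poly a \<longlongrightarrow> poly a z) (at z)"
    using poly_isCont isCont_def by blast
  ultimately have "filterlim (\<lambda>s. poly a s / poly b s) at_infinity (at z)"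
    using filterlim_divide_at_infinity by blast
  moreover have "eventually (\<lambda>s. f s = poly a s / poly b s) (at z)"
    using assms(4) eventually_off_finite by auto
  ultimately show ?thesis
    unfolding is_pole_def using filterlim_cong by fastforce
qed

lemma rational_fun_limit_or_pole:
  assumes "rational_fun f"
  shows "(\<exists>l. (f \<longlongrightarrow> l) (at z)) \<or> is_pole f z"
proof -
  obtain a b where f: "b \<noteq> 0" "coprime a b" "finite {s. f s \<noteq> poly a s / poly b s}"
    using rational_fun_lowest_terms[OF assms] .
  show ?thesis
  proof (cases "poly b z = 0")
    case True
    then show ?thesis using quotient_pole f by blast
  next
    case False
    then have "((\<lambda>s. poly a s / poly b s) \<longlongrightarrow> poly a z / poly b z) (at z)"
      using poly_isCont isCont_def by (intro tendsto_divide) blast+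
    moreover have "eventually (\<lambda>s. f s = poly a s / poly b s) (at z)"
      using f(3) eventually_off_finite by auto
    ultimately have "(f \<longlongrightarrow> poly a z / poly b z) (at z)"
      using tendsto_cong by fastforce
    then show ?thesis by blast
  qed
qed

text \<open>Liouville's theorem for rational functions: without poles the reduced denominator has no
  root, hence is constant, and a polynomial that tends to 0 at infinity is 0.\<close>

lemma rational_fun_without_poles_vanishing:
  assumes "rational_fun f" "\<And>z. \<exists>l. (f \<longlongrightarrow> l) (at z)" "(f \<longlongrightarrow> 0) at_infinity"
  shows "finite {s. f s \<noteq> 0}"
proof -
  obtain a b where f: "b \<noteq> 0" "coprime a b" and fin: "finite {s. f s \<noteq> poly a s / poly b s}"
    using rational_fun_lowest_terms[OF assms(1)] .
  have no_root: "poly b z \<noteq> 0" for z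
  proof
    assume "poly b z = 0"
    then have "is_pole f z" using quotient_pole f fin by blast
    moreover obtain l where "(f \<longlongrightarrow> l) (at z)" using assms(2) by blast
    ultimately show False
      unfolding is_pole_def
      using not_tendsto_and_filterlim_at_infinity[OF at_neq_bot[of z], of f l] by blast
  qed
  have "constant (poly b)"
  proof (rule ccontr)
    assume "\<not> constant (poly b)"
    from Fundamental_Theorem_Algebra.fundamental_theorem_of_algebra[OF this] no_root show False by blast
  qed
  then have "degree b = 0" by (simp add: constant_degree)
  then obtain c where c: "b = [:c:]" by (rule degree_eq_zeroE)
  define p where "p = smult (1 / c) a"
  have p: "finite {s. f s \<noteq> poly p s}"
    using fin by (simp add: c p_def)
  have "eventually (\<lambda>s. f s = poly p s) at_infinity"
    using p eventually_at_infinity_off_finite by auto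
  then have lim: "(poly p \<longlongrightarrow> 0) at_infinity"
    using assms(3) tendsto_cong by fastforce
  have "p = 0"
  proof (rule ccontr)
    assume "p \<noteq> 0"
    show False
    proof (cases p rule: pCons_cases)
      case (pCons c0 q)
      show False
      proof (cases "q = 0")
        case True
        then have "((\<lambda>s::complex. c0) \<longlongrightarrow> 0) at_infinity" using lim pCons
          by (simp add: poly_pCons[abs_def])
        then have "c0 = 0" using tendsto_unique[OF trivial_limit_at_infinity _ tendsto_const] by metis
        then show False using True pCons \<open>p \<noteq> 0\<close> by simp
      next
        case False
        have "eventually (\<lambda>s. norm (poly p s) < 1) at_infinity"
          using lim tendstoD[OF lim, of 1] by simp
        then obtain r where r: "\<And>s. r \<le> norm s \<Longrightarrow> norm (poly p s) < 1"
          unfolding eventually_at_infinity by blast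
        obtain r' where r': "\<And>s. r' \<le> norm s \<Longrightarrow> 1 \<le> norm (poly (pCons c0 q) s)"
          using poly_infinity[OF False, of 1 c0] by blast
        have "norm (of_real (\<bar>r\<bar> + \<bar>r'\<bar>) :: complex) = \<bar>r\<bar> + \<bar>r'\<bar>" by (metis abs_add_abs norm_of_real)
        then have "r \<le> norm (of_real (\<bar>r\<bar> + \<bar>r'\<bar>) :: complex)"
          "r' \<le> norm (of_real (\<bar>r\<bar> + \<bar>r'\<bar>) :: complex)" by linarith+
        from r[OF this(1)] r'[OF this(2)] pCons show False by simp
      qed
    qed
  qed
  then show ?thesis using p by simp
qed

lemma entry_pole_imp_is_pole:
  fixes F :: "complex \<Rightarrow> complex^'m^'p"
  assumes "is_pole (\<lambda>s. F s $ i $ j) z"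
  shows "is_pole F z"
proof -
  have "norm (F s $ i $ j) \<le> norm (F s)" for s
    using Finite_Cartesian_Product.norm_nth_le[of "F s $ i" j] Finite_Cartesian_Product.norm_nth_le[of "F s" i] by linarith
  moreover have "filterlim (\<lambda>s. norm (F s $ i $ j)) at_top (at z)"
    using assms unfolding is_pole_def by (rule filterlim_at_infinity_imp_norm_at_top)
  ultimately have "filterlim (\<lambda>s. norm (F s)) at_top (at z)"
    by (rule filterlim_at_top_mono[OF _ always_eventually, OF _ allI, rotated])
  then show ?thesis
    unfolding is_pole_def by (rule filterlim_norm_at_top_imp_at_infinity)
qed

lemma isCont_not_pole:
  fixes F :: "complex \<Rightarrow> 'a::real_normed_vector"
  assumes "isCont F z"
  shows "\<not> is_pole F z"
  using assms not_tendsto_and_filterlim_at_infinity[OF at_neq_bot[of z], of F "F z"]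
  unfolding is_pole_def isCont_def by blast

lemma rational_matrix_limit_or_pole:
  fixes F :: "complex \<Rightarrow> complex^'m^'p"
  assumes "rational_matrix F" "\<not> is_pole F z"
  shows "\<exists>l. (F \<longlongrightarrow> l) (at z)"
proof -
  have "\<exists>l. ((\<lambda>s. F s $ i $ j) \<longlongrightarrow> l) (at z)" for i j
    using assms rational_fun_limit_or_pole[of "\<lambda>s. F s $ i $ j" z] entry_pole_imp_is_pole[of F i j z]
    unfolding rational_matrix_entries by blast
  then obtain l where "\<And>i j. ((\<lambda>s. F s $ i $ j) \<longlongrightarrow> l i j) (at z)" by metis
  then have "(F \<longlongrightarrow> (\<chi> i j. l i j)) (at z)"
    by (auto intro!: vec_tendstoI)
  then show ?thesis by blast
qed

lemma rational_matrix_finite_discontinuities: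
  fixes F :: "complex \<Rightarrow> complex^'m^'p"
  assumes "rational_matrix F"
  shows "finite {s. \<not> isCont F s}"
proof -
  have "\<exists>b. b \<noteq> 0 \<and> (\<forall>s. poly b s \<noteq> 0 \<longrightarrow> isCont (\<lambda>s. F s $ i $ j) s)" for i j
  proof -
    obtain a b where f: "b \<noteq> 0" "\<And>s. poly b s \<noteq> 0 \<Longrightarrow> F s $ i $ j = poly a s / poly b s"
      using assms unfolding rational_matrix_def by blast
    have "isCont (\<lambda>s. F s $ i $ j) s" if "poly b s \<noteq> 0" for s
    proof -
      have "eventually (\<lambda>t. poly b t \<noteq> 0) (nhds s)"
        using poly_isCont[where p=b and x=s] that
        by (intro tendsto_imp_eventually_ne[where c="poly b s"])
           (auto simp: isCont_def  tendsto_at_iff_tendsto_nhds)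
      then have "eventually (\<lambda>t. F t $ i $ j = poly a t / poly b t) (nhds s)"
        by eventually_elim (rule f(2))
      moreover have "isCont (\<lambda>t. poly a t / poly b t) s"
        using that by (intro isCont_divide poly_isCont)
      ultimately show ?thesis by (simp add: isCont_cong)
    qed
    then show ?thesis using f(1) by blast
  qed
  then obtain b where b: "\<And>i j. b i j \<noteq> 0"
      "\<And>i j s. poly (b i j) s \<noteq> 0 \<Longrightarrow> isCont (\<lambda>s. F s $ i $ j) s"
    by metis
  have "isCont F s" if "\<And>i j. isCont (\<lambda>s. F s $ i $ j) s" for s
    using that unfolding isCont_def by (auto intro!: vec_tendstoI)
  then have "{s. \<not> isCont F s} \<subseteq> (\<Union>i j. {s. poly (b i j) s = 0})"
    using b(2) by fastforce
  moreover have "finite (\<Union>i j. {s. poly (b i j) s = 0})"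
    using b(1) poly_roots_finite by auto
  ultimately show ?thesis using finite_subset by blast
qed

text \<open>The difference of the two stable summands equals a difference of antistable summands, so it
  has no pole in the open left half-plane and none outside it. Being strictly proper, it
  vanishes.\<close>

lemma stable_decomposition_unique:
  fixes F :: "complex \<Rightarrow> complex^'m^'p"
  assumes "stable_decomposition F H1 E1" "stable_decomposition F H2 E2"
  shows "finite {s. H1 s \<noteq> H2 s}"
proof -
  note d = assms[unfolded stable_decomposition_def strictly_proper_def]
  have fin: "finite {s. H1 s - H2 s \<noteq> E2 s - E1 s}"
  proof (rule finite_subset)
    show "{s. H1 s - H2 s \<noteq> E2 s - E1 s} \<subseteq> {s. F s \<noteq> H1 s + E1 s} \<union> {s. F s \<noteq> H2 s + E2 s}"
    proof
      fix s assume "s \<in> {s. H1 s - H2 s \<noteq> E2 s - E1 s}"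
      then have "H1 s + E1 s \<noteq> H2 s + E2 s" by (simp add: algebra_simps)
      then show "s \<in> {s. F s \<noteq> H1 s + E1 s} \<union> {s. F s \<noteq> H2 s + E2 s}" by force
    qed
    show "finite ({s. F s \<noteq> H1 s + E1 s} \<union> {s. F s \<noteq> H2 s + E2 s})" using d by blast
  qed
  have "finite {s. H1 s $ i $ j - H2 s $ i $ j \<noteq> 0}" for i j
  proof (rule rational_fun_without_poles_vanishing)
    show "rational_fun (\<lambda>s. H1 s $ i $ j - H2 s $ i $ j)"
      using d by (intro rational_fun_diff) (auto simp: rational_matrix_entries)
    have "((\<lambda>s. H1 s $ i $ j - H2 s $ i $ j) \<longlongrightarrow> 0 $ i $ j - 0 $ i $ j) at_infinity"
      using d by (intro tendsto_intros) auto
    then show "((\<lambda>s. H1 s $ i $ j - H2 s $ i $ j) \<longlongrightarrow> 0) at_infinity" by simp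
    fix z
    show "\<exists>l. ((\<lambda>s. H1 s $ i $ j - H2 s $ i $ j) \<longlongrightarrow> l) (at z)"
    proof (cases "Re z < 0")
      case False
      then obtain l1 l2 where "(H1 \<longlongrightarrow> l1) (at z)" "(H2 \<longlongrightarrow> l2) (at z)"
        using d rational_matrix_limit_or_pole by metis
      then have "((\<lambda>s. H1 s $ i $ j - H2 s $ i $ j) \<longlongrightarrow> l1 $ i $ j - l2 $ i $ j) (at z)"
        by (intro tendsto_intros)
      then show ?thesis by blast
    next
      case True
      then obtain l1 l2 where "(E1 \<longlongrightarrow> l1) (at z)" "(E2 \<longlongrightarrow> l2) (at z)"
        using d rational_matrix_limit_or_pole by metis
      then have "((\<lambda>s. E2 s $ i $ j - E1 s $ i $ j) \<longlongrightarrow> l2 $ i $ j - l1 $ i $ j) (at z)"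
        by (intro tendsto_intros)
      moreover have "eventually (\<lambda>s. H1 s - H2 s = E2 s - E1 s) (at z)"
        using fin eventually_off_finite by auto
      then have "eventually (\<lambda>s. H1 s $ i $ j - H2 s $ i $ j = E2 s $ i $ j - E1 s $ i $ j) (at z)"
        by eventually_elim (metis vector_minus_component)
      ultimately have "((\<lambda>s. H1 s $ i $ j - H2 s $ i $ j) \<longlongrightarrow> l2 $ i $ j - l1 $ i $ j) (at z)"
        using tendsto_cong by fastforce
      then show ?thesis by blast
    qed
  qed
  then have "finite (\<Union>i j. {s. H1 s $ i $ j - H2 s $ i $ j \<noteq> 0})" by auto
  moreover have "{s. H1 s \<noteq> H2 s} \<subseteq> (\<Union>i j. {s. H1 s $ i $ j - H2 s $ i $ j \<noteq> 0})"
    by (auto simp: vec_eq_iff)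
  ultimately show ?thesis using finite_subset by blast
qed

lemma is_pole_cong_off_finite:
  fixes F H :: "complex \<Rightarrow> 'a::real_normed_vector"
  assumes "finite {s. F s \<noteq> H s}"
  shows "is_pole F z \<longleftrightarrow> is_pole H z"
  using eventually_off_finite[of "\<lambda>s. F s = H s" z] assms
  by (intro is_pole_cong) auto

lemma tendsto_cong_off_finite:
  fixes F :: "complex \<Rightarrow> 'a::topological_space"
  assumes "finite {s. F s \<noteq> H s}"
  shows "(F \<longlongrightarrow> l) (at z) \<longleftrightarrow> (H \<longlongrightarrow> l) (at z)"
  using eventually_off_finite[of "\<lambda>s. F s = H s" z] assms
  by (intro tendsto_cong) auto

lemma rational_fun_cong_off_finite:
  assumes "rational_fun f" "finite {s. f s \<noteq> g s}"
  shows "rational_fun g"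
proof -
  obtain a b where f: "b \<noteq> 0" "\<And>s. poly b s \<noteq> 0 \<Longrightarrow> f s = poly a s / poly b s"
    using assms(1) unfolding rational_fun_def by blast
  \<comment> \<open>An extra denominator that excludes the exceptional points.\<close>
  define c where "c = (\<Prod>z\<in>{s. f s \<noteq> g s}. [:- z, 1:])"
  have c: "poly c s = 0 \<longleftrightarrow> f s \<noteq> g s" for s
    using assms(2) by (simp add: c_def poly_prod)
  have "c \<noteq> 0" using assms(2) by (simp add: c_def)
  then have "c * b \<noteq> 0" using f(1) by simp
  moreover have "g s = poly (c * a) s / poly (c * b) s" if "poly (c * b) s \<noteq> 0" for s
    using that c[of s] f(2)[of s] by simp
  ultimately show ?thesis unfolding rational_fun_def by blast
qed

lemma strictly_proper_cong_off_finite: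
  fixes F :: "complex \<Rightarrow> complex^'m^'p"
  assumes "strictly_proper F" and fin: "finite {s. F s \<noteq> H s}"
  shows "strictly_proper H"
proof -
  have "finite {s. F s $ i $ j \<noteq> H s $ i $ j}" for i j
    by (rule finite_subset[OF _ fin]) auto
  then have "rational_fun (\<lambda>s. H s $ i $ j)" for i j
    using assms(1) rational_fun_cong_off_finite[of "\<lambda>s. F s $ i $ j" "\<lambda>s. H s $ i $ j"]
    unfolding strictly_proper_def rational_matrix_entries by blast
  then have "rational_matrix H" by (simp add: rational_matrix_entries)
  moreover have "(H \<longlongrightarrow> 0) at_infinity"
    using assms(1) tendsto_cong[OF eventually_at_infinity_off_finite, of F H] fin
    unfolding strictly_proper_def by blast
  ultimately show ?thesis unfolding strictly_proper_def by blast
qed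

text \<open>Any stable summand determines the stable part, although its values at finitely many points
  may have to be corrected first: the corrected function takes the limit of \<open>H\<close> where there is
  one and 0 at the poles. At a point of continuity nothing is changed.\<close>

lemma stable_part_eqI:
  fixes F :: "complex \<Rightarrow> complex^'m^'p"
  assumes dec: "stable_decomposition F H E" and cont: "isCont H s"
  shows "stable_part F s = H s"
proof -
  note d = dec[unfolded stable_decomposition_def strictly_proper_def]
  define H' where "H' z = (if is_pole H z then 0 else Lim (at z) H)" for z
  have H'_cont: "H' z = H z" if "isCont H z" for z
  proof -
    have "(H \<longlongrightarrow> H z) (at z)" using that isCont_def by blast
    moreover have "\<not> is_pole H z" using isCont_not_pole that by blast
    ultimately show ?thesis
      unfolding H'_def using tendsto_Lim[OF at_neq_bot[of z], of H] by simp
  qed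
  then have "{z. H z \<noteq> H' z} \<subseteq> {z. \<not> isCont H z}" by force
  then have fin: "finite {z. H z \<noteq> H' z}"
    using rational_matrix_finite_discontinuities d finite_subset by blast
  have pole: "is_pole H' z \<longleftrightarrow> is_pole H z" for z
    using is_pole_cong_off_finite[OF fin] by simp
  have spec: "\<forall>z. \<not> is_pole H' z \<longrightarrow> isCont H' z" "\<forall>z. is_pole H' z \<longrightarrow> H' z = 0"
  proof safe
    fix z
    show "H' z = 0" if "is_pole H' z" using that pole H'_def by simp
    assume np: "\<not> is_pole H' z"
    then obtain l where l: "(H \<longlongrightarrow> l) (at z)"
      using d rational_matrix_limit_or_pole pole by blast
    then have "H' z = l"
      using np pole tendsto_Lim[OF at_neq_bot[of z], of H] unfolding H'_def by simp
    then show "isCont H' z"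
      using l tendsto_cong_off_finite[OF fin] isCont_def by blast
  qed
  have "finite {s. F s \<noteq> H' s + E s}"
  proof (rule finite_subset)
    show "{s. F s \<noteq> H' s + E s} \<subseteq> {s. F s \<noteq> H s + E s} \<union> {s. H s \<noteq> H' s}" by auto
    show "finite ({s. F s \<noteq> H s + E s} \<union> {s. H s \<noteq> H' s})" using d fin by blast
  qed
  then have "stable_decomposition F H' E"
    using dec strictly_proper_cong_off_finite[OF _ fin] pole
    unfolding stable_decomposition_def by blast
  have "stable_part F = H'"
    unfolding stable_part_def
  proof (rule the_equality)
    show "(\<exists>E. stable_decomposition F H' E) \<and> (\<forall>z. \<not> is_pole H' z \<longrightarrow> isCont H' z) \<and>
      (\<forall>z. is_pole H' z \<longrightarrow> H' z = 0)"
      using spec \<open>stable_decomposition F H' E\<close> by blast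
    fix H2
    assume H2: "(\<exists>E. stable_decomposition F H2 E) \<and> (\<forall>z. \<not> is_pole H2 z \<longrightarrow> isCont H2 z) \<and>
      (\<forall>z. is_pole H2 z \<longrightarrow> H2 z = 0)"
    then have fin2: "finite {s. H2 s \<noteq> H' s}"
      using stable_decomposition_unique \<open>stable_decomposition F H' E\<close> by blast
    show "H2 = H'"
    proof
      fix z
      show "H2 z = H' z"
      proof (cases "is_pole H' z")
        case True
        then show ?thesis using H2 spec is_pole_cong_off_finite[OF fin2] by simp
      next
        case False
        then have "(H2 \<longlongrightarrow> H2 z) (at z)" "(H' \<longlongrightarrow> H' z) (at z)"
          using H2 spec is_pole_cong_off_finite[OF fin2] isCont_def by blast+
        then show ?thesis
          using tendsto_cong_off_finite[OF fin2] tendsto_unique[OF at_neq_bot[of z], of H2] by blast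
      qed
    qed
  qed
  then show ?thesis using H'_cont[OF cont] by simp
qed

section \<open>The resolvent of a real matrix\<close>

lemma matrix_mul_minus_left: "(- M) ** N = - (M ** N :: 'a::ring_1^'m^'p)"
  by (simp add: matrix_matrix_mult_def vec_eq_iff sum_negf)

lemma matrix_mul_minus_right: "M ** (- N) = - (M ** N :: 'a::ring_1^'m^'p)"
  by (simp add: matrix_matrix_mult_def vec_eq_iff sum_negf)

lemma matrix_mul_add_left: "(M + N) ** L = M ** L + (N ** L :: 'a::ring_1^'m^'p)"
  by (simp add: matrix_matrix_mult_def vec_eq_iff sum.distrib distrib_right)

lemma matrix_diff_ldistrib: "M ** (N - L) = M ** N - (M ** L :: 'a::ring_1^'m^'p)"
  by (simp add: matrix_matrix_mult_def vec_eq_iff sum_subtractf right_diff_distrib)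

lemma matrix_diff_rdistrib: "(M - N) ** L = M ** L - (N ** L :: 'a::ring_1^'m^'p)"
  by (simp add: matrix_matrix_mult_def vec_eq_iff sum_subtractf left_diff_distrib)

lemma matrix_mul_zero_left: "0 ** M = (0 :: 'a::ring_1^'m^'p)"
  by (simp add: matrix_matrix_mult_def vec_eq_iff)

lemma matrix_mul_zero_right: "M ** 0 = (0 :: 'a::ring_1^'m^'p)"
  by (simp add: matrix_matrix_mult_def vec_eq_iff)

lemmas matrix_ring_simps =
  matrix_mul_minus_left matrix_mul_minus_right matrix_add_ldistrib matrix_mul_add_left
  matrix_diff_ldistrib matrix_diff_rdistrib matrix_mul_zero_left matrix_mul_zero_right

lemma transpose_add: "transpose (M + N) = transpose M + transpose N"
  by (simp add: transpose_def vec_eq_iff)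

lemma transpose_diff: "transpose (M - N) = transpose M - transpose N"
  by (simp add: transpose_def vec_eq_iff)

lemma transpose_minus: "transpose (- M) = - transpose M"
  by (simp add: transpose_def vec_eq_iff)

lemma cmat_mult: "cmat (M ** N) = cmat M ** cmat N"
  by (simp add: matrix_matrix_mult_def vec_eq_iff)

lemma cmat_add: "cmat (M + N) = cmat M + cmat N"
  by (simp add: vec_eq_iff)

lemma cmat_diff: "cmat (M - N) = cmat M - cmat N"
  by (simp add: vec_eq_iff)

lemma cmat_minus: "cmat (- M) = - cmat M"
  by (simp add: vec_eq_iff)

lemma cmat_one: "cmat (mat 1) = mat 1"
  by (simp add: vec_eq_iff mat_def)

lemma cmat_zero: "cmat 0 = 0"
  by (simp add: vec_eq_iff)

lemma cmat_transpose: "cmat (transpose M) = transpose (cmat M)"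
  by (simp add: vec_eq_iff transpose_def)

lemmas cmat_hom = cmat_mult cmat_add cmat_diff cmat_minus cmat_one cmat_zero cmat_transpose

lemma mat_mult_scalar: "mat s *v x = s *s (x :: 'a::semiring_1^'n)"
  by (simp add: vec_eq_iff matrix_vector_mult_def mat_def if_distrib if_distribR sum.delta cong: if_cong)

lemma mult_axis_component: "(M *v axis j 1) $ i = (M :: 'a::semiring_1^'n^'m) $ i $ j"
  by (simp add: matrix_vector_mult_def axis_def if_distrib sum.delta cong: if_cong)

lemma norm_scalar_mult: "norm (s *s x) = norm s * norm (x :: complex^'n)"
  by (simp add: norm_vec_def L2_set_right_distrib norm_mult)

lemma matrix_inv_inverse:
  assumes "invertible M"
  shows "M ** matrix_inv M = mat 1" "matrix_inv M ** M = mat 1"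
  using someI_ex[OF assms[unfolded invertible_def]] unfolding matrix_inv_def by auto

lemma resolvent_inverse:
  assumes "invertible (mat s - cmat M)"
  shows "(mat s - cmat M) ** resolvent M s = mat 1" "resolvent M s ** (mat s - cmat M) = mat 1"
  using matrix_inv_inverse[OF assms] unfolding resolvent_def by auto

lemma matrix_inv_unique:
  fixes M N :: "'a::field^'n^'n"
  assumes "M ** N = mat 1"
  shows "matrix_inv M = N"
proof -
  have "invertible M" using assms invertible_right_inverse by blast
  then have "matrix_inv M ** (M ** N) = N"
    by (simp add: matrix_mul_assoc matrix_inv_inverse)
  then show ?thesis using assms by simp
qed

lemma not_invertible_imp_eigenvector:
  assumes "\<not> invertible (mat s - cmat M)"
  obtains v where "v \<noteq> 0" "cmat M *v v = s *s v"
proof -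
  obtain v where "v \<noteq> 0" "(mat s - cmat M) *v v = 0"
    using assms unfolding invertible_left_inverse matrix_left_invertible_ker by blast
  then show ?thesis
    using that by (simp add: matrix_vector_mult_diff_rdistrib mat_mult_scalar)
qed

text \<open>The bound \<open>k\<close> is the operator norm of \<open>M\<close>: outside the disc of this radius
  \<open>\<bar>(s - M)x\<bar> \<ge> (\<bar>s\<bar> - k)\<bar>x\<bar>\<close>. This serves twice, for the decay of the resolvent at infinity and
  for the fact that the characteristic polynomial is not 0.\<close>

lemma resolvent_far_out:
  fixes M :: "real^'n^'n"
  shows "\<exists>k. \<forall>s. k < norm s \<longrightarrow> invertible (mat s - cmat M) \<and>
    (\<forall>x. norm (resolvent M s *v x) * (norm s - k) \<le> norm x)"
proof -
  obtain k where k: "\<And>x. norm (cmat M *v x) \<le> norm x * k"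
    using bounded_linear.bounded[OF matrix_vector_mul_bounded_linear[of "cmat M"]] by blast
  have inv: "invertible (mat s - cmat M)" if "k < norm s" for s
  proof (rule ccontr)
    assume "\<not> invertible (mat s - cmat M)"
    then obtain v where v: "v \<noteq> 0" "cmat M *v v = s *s v"
      by (rule not_invertible_imp_eigenvector)
    then have "norm s * norm v \<le> norm v * k" using k[of v] by (simp add: norm_scalar_mult)
    then show False using v(1) that by (simp add: mult.commute)
  qed
  have "norm (resolvent M s *v x) * (norm s - k) \<le> norm x" if "k < norm s" for s x
  proof -
    define y where "y = resolvent M s *v x"
    have "(mat s - cmat M) *v y = x"
      using resolvent_inverse(1)[OF inv[OF that]]
      by (simp add: y_def matrix_vector_mul_assoc)
    then have "s *s y = x + cmat M *v y"
      by (simp add: matrix_vector_mult_diff_rdistrib mat_mult_scalar algebra_simps)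
    then have "norm s * norm y \<le> norm x + norm (cmat M *v y)"
      by (metis norm_scalar_mult norm_triangle_ineq)
    then show ?thesis using k[of y] by (simp add: y_def[symmetric] algebra_simps)
  qed
  with inv show ?thesis by blast
qed

text \<open>Evaluation at a point is a ring homomorphism, so it commutes with the determinant. This gives
  the characteristic polynomial, and the cofactors below, as determinants over the polynomial
  ring.\<close>

lemma det_poly:
  fixes X :: "('a::comm_ring_1 poly)^'n^'n"
  shows "poly (det X) s = det (\<chi> i j. poly (X $ i $ j) s)"
  by (simp add: det_def poly_sum poly_prod)

text \<open>Cramer's rule, with the characteristic polynomial as a common denominator of all entries.\<close>

lemma resolvent_rational:
  fixes M :: "real^'n^'n"
  shows "\<exists>d a. d \<noteq> 0 \<and> (\<forall>s. invertible (mat s - cmat M) \<longleftrightarrow> poly d s \<noteq> 0) \<and>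
    (\<forall>s i j. poly d s \<noteq> 0 \<longrightarrow> resolvent M s $ i $ j = poly (a i j) s / poly d s)"
proof -
  define X :: "complex poly^'n^'n"
    where "X = (\<chi> i j. (if i = j then [:0, 1:] else 0) - [:complex_of_real (M $ i $ j):])"
  have X: "(\<chi> i j. poly (X $ i $ j) s) = mat s - cmat M" for s
    by (simp add: X_def vec_eq_iff mat_def)
  define a where
    "a = (\<lambda>k l. det (\<chi> i j. if j = k then (axis l 1 :: complex poly^'n) $ i else X $ i $ j))"
  have det: "poly (det X) s = det (mat s - cmat M)" for s
    by (simp add: det_poly X)
  have inv: "invertible (mat s - cmat M) \<longleftrightarrow> poly (det X) s \<noteq> 0" for s
    by (simp add: det invertible_det_nz)
  have "resolvent M s $ k $ l = poly (a k l) s / poly (det X) s" if "poly (det X) s \<noteq> 0" for s k l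
  proof -
    define x where "x = resolvent M s *v axis l 1"
    have x: "(mat s - cmat M) *v x = axis l 1"
      using resolvent_inverse(1)[of s M] inv[of s] that
      by (simp add: x_def matrix_vector_mul_assoc)
    have "poly (a k l) s = det (\<chi> i j. if j = k then (axis l 1 :: complex^'n) $ i else (mat s - cmat M) $ i $ j)"
      unfolding a_def det_poly X[symmetric]
      by (rule arg_cong[of _ _ det]) (simp add: vec_eq_iff axis_def)
    also have "\<dots> = x $ k * poly (det X) s"
      unfolding det using cramer_lemma[of k "mat s - cmat M" x] unfolding x .
    finally have "x $ k = poly (a k l) s / poly (det X) s" using that by simp
    then show ?thesis by (simp add: x_def mult_axis_component)
  qed
  moreover have "det X \<noteq> 0"
  proof -
    obtain k where k: "\<And>s. k < norm s \<Longrightarrow> invertible (mat s - cmat M)"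
      using resolvent_far_out[of M] by blast
    have "invertible (mat (of_real (\<bar>k\<bar> + 1)) - cmat M)"
      by (rule k) (simp only: norm_of_real)
    then show ?thesis using inv by fastforce
  qed
  ultimately show ?thesis using inv by (intro exI[of _ "det X"] exI[of _ a]) simp
qed

lemma finite_spectrum: "finite {s. \<not> invertible (mat s - cmat M)}"
proof -
  obtain d a where "d \<noteq> 0" "\<And>s. invertible (mat s - cmat M) \<longleftrightarrow> poly d s \<noteq> 0"
    and "\<And>s i j. poly d s \<noteq> 0 \<Longrightarrow> resolvent M s $ i $ j = poly (a i j) s / poly d s"
    using resolvent_rational[of M] by auto
  then show ?thesis using poly_roots_finite by simp
qed

lemma resolvent_tendsto_0: "(resolvent M \<longlongrightarrow> 0) at_infinity"
proof -
  obtain k where k: "\<And>s x. k < norm s \<Longrightarrow> norm (resolvent M s *v x) * (norm s - k) \<le> norm x"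
    using resolvent_far_out[of M] by auto
  have "((\<lambda>s. resolvent M s $ i $ j) \<longlongrightarrow> 0) at_infinity" for i j
  proof (rule Lim_null_comparison)
    have "filterlim (\<lambda>s::complex. norm s - k) at_top at_infinity"
      using filterlim_tendsto_add_at_top[OF tendsto_const[of "- k"] filterlim_norm_at_top] by simp
    then show "((\<lambda>s::complex. 1 / (norm s - k)) \<longlongrightarrow> 0) at_infinity"
      by (intro tendsto_divide_0[OF tendsto_const] filterlim_at_top_imp_at_infinity)
    show "eventually (\<lambda>s. norm (resolvent M s $ i $ j) \<le> 1 / (norm s - k)) at_infinity"
      unfolding eventually_at_infinity
    proof (intro exI[of _ "k + 1"] allI impI)
      fix s :: complex assume "k + 1 \<le> norm s"
      then have s: "k < norm s" by simp
      have "norm (resolvent M s $ i $ j) = norm ((resolvent M s *v axis j 1) $ i)"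
        by (simp add: mult_axis_component)
      also have "\<dots> \<le> norm (resolvent M s *v axis j 1)"
        by (rule Finite_Cartesian_Product.norm_nth_le)
      also have "\<dots> \<le> 1 / (norm s - k)"
        using k[OF s, of "axis j 1"] s by (simp add: pos_le_divide_eq norm_axis_1)
      finally show "norm (resolvent M s $ i $ j) \<le> 1 / (norm s - k)" .
    qed
  qed
  then show ?thesis by (auto intro!: vec_tendstoI)
qed

lemma tendsto_matrix_mult:
  fixes F :: "'x \<Rightarrow> complex^'n^'p" and H :: "'x \<Rightarrow> complex^'m^'n"
  assumes "(F \<longlongrightarrow> X) net" "(H \<longlongrightarrow> Y) net"
  shows "((\<lambda>x. F x ** H x) \<longlongrightarrow> X ** Y) net"
  unfolding matrix_matrix_mult_def
  by (intro vec_tendstoI) (auto intro!: tendsto_intros assms)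

lemma realization_tendsto_0:
  "((\<lambda>s. cmat L ** resolvent M s ** cmat N) \<longlongrightarrow> 0) at_infinity"
  using tendsto_matrix_mult[OF tendsto_matrix_mult[OF tendsto_const resolvent_tendsto_0] tendsto_const,
      of "cmat L" M "cmat N"]
  by (simp add: matrix_ring_simps)

lemma realization_strictly_proper:
  "strictly_proper (\<lambda>s. cmat L ** resolvent M s ** cmat N)"
proof -
  obtain d a where "d \<noteq> 0" and "\<And>s. invertible (mat s - cmat M) \<longleftrightarrow> poly d s \<noteq> 0"
    and res: "\<And>s i j. poly d s \<noteq> 0 \<Longrightarrow> resolvent M s $ i $ j = poly (a i j) s / poly d s"
    using resolvent_rational[of M] by auto
  define c where "c i j =
    (\<Sum>k\<in>UNIV. \<Sum>l\<in>UNIV. smult (complex_of_real (L $ i $ l) * complex_of_real (N $ k $ j)) (a l k))" for i j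
  have c: "(cmat L ** resolvent M s ** cmat N) $ i $ j = poly (c i j) s / poly d s"
    if "poly d s \<noteq> 0" for s i j
  proof -
    have "(cmat L ** resolvent M s ** cmat N) $ i $ j =
        (\<Sum>k\<in>UNIV. (\<Sum>l\<in>UNIV. complex_of_real (L $ i $ l) * resolvent M s $ l $ k) * complex_of_real (N $ k $ j))"
      by (simp add: matrix_matrix_mult_def)
    also have "\<dots> = (\<Sum>k\<in>UNIV. \<Sum>l\<in>UNIV.
        poly (smult (complex_of_real (L $ i $ l) * complex_of_real (N $ k $ j)) (a l k)) s / poly d s)"
      unfolding sum_distrib_right res[OF that] by (simp add: mult_ac)
    finally show ?thesis by (simp only: c_def poly_sum sum_divide_distrib)
  qed
  have "rational_matrix (\<lambda>s. cmat L ** resolvent M s ** cmat N)"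
    unfolding rational_matrix_def
  proof (intro allI)
    fix i j
    show "\<exists>a b. b \<noteq> 0 \<and>
      (\<forall>s. poly b s \<noteq> 0 \<longrightarrow> (cmat L ** resolvent M s ** cmat N) $ i $ j = poly a s / poly b s)"
      using c \<open>d \<noteq> 0\<close> by (intro exI[of _ "c i j"] exI[of _ d]) simp
  qed
  then show ?thesis
    unfolding strictly_proper_def using realization_tendsto_0[of L M N] by simp
qed

lemma realization_isCont:
  assumes "invertible (mat z - cmat M)"
  shows "isCont (\<lambda>s. cmat L ** resolvent M s ** cmat N) z"
proof -
  obtain d a where "d \<noteq> 0" and d: "\<And>s. invertible (mat s - cmat M) \<longleftrightarrow> poly d s \<noteq> 0"
    "\<And>s i j. poly d s \<noteq> 0 \<Longrightarrow> resolvent M s $ i $ j = poly (a i j) s / poly d s"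
    using resolvent_rational[of M] by auto
  have z: "poly d z \<noteq> 0" using assms d(1) by simp
  have "eventually (\<lambda>s. poly d s \<noteq> 0) (at z)"
    using z by (intro tendsto_imp_eventually_ne[where c="poly d z"])
      (use poly_isCont[where p=d and x=z] in \<open>auto simp: isCont_def\<close>)
  then have ev: "eventually (\<lambda>s. poly (a i j) s / poly d s = resolvent M s $ i $ j) (at z)" for i j
    by eventually_elim (simp add: d(2))
  have "((\<lambda>s. resolvent M s $ i $ j) \<longlongrightarrow> resolvent M z $ i $ j) (at z)" for i j
  proof -
    have "((\<lambda>s. poly (a i j) s / poly d s) \<longlongrightarrow> poly (a i j) z / poly d z) (at z)"
      using isCont_divide[OF poly_isCont poly_isCont z] unfolding isCont_def .
    then show ?thesis using tendsto_cong[OF ev] d(2)[OF z] by simp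
  qed
  then have "(resolvent M \<longlongrightarrow> resolvent M z) (at z)" by (auto intro!: vec_tendstoI)
  then show ?thesis unfolding isCont_def by (intro tendsto_matrix_mult tendsto_const)
qed

section \<open>Low-rank solutions of a quadratic matrix equation\<close>

text \<open>These rules rewrite \<open>M\<^sup>T x\<close> to \<open>x M\<close>, which would hide left eigenvectors as eigenvectors of the
  transpose.\<close>

declare transpose_matrix_vector [simp del] vector_transpose_matrix [simp del]

definition outer :: "real^'p \<Rightarrow> real^'m \<Rightarrow> real^'m^'p"
  where "outer x y = (\<chi> i j. x $ i * y $ j)"

lemma matrix_mult_outer: "M ** outer x y = outer (M *v x) y"
  by (simp add: outer_def vec_eq_iff matrix_matrix_mult_def matrix_vector_mult_def sum_distrib_left mult_ac)

lemma outer_mult_outer: "outer x y ** outer y' z = (y \<bullet> y') *\<^sub>R outer x z"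
  by (simp add: outer_def vec_eq_iff matrix_matrix_mult_def inner_vec_def sum_distrib_right sum_distrib_left mult_ac)

lemma outer_mult_vector: "outer x y *v z = (y \<bullet> z) *\<^sub>R x"
  by (simp add: outer_def vec_eq_iff matrix_vector_mult_def inner_vec_def sum_distrib_left mult_ac)

lemma transpose_outer: "transpose (outer x y) = outer y x"
  by (simp add: outer_def vec_eq_iff transpose_def mult_ac)

text \<open>Both sides are bilinear forms in \<open>(x, y)\<close> and \<open>(x', y')\<close>; the hypotheses are the equalities of
  their coefficients.\<close>

lemma low_rank_riccati_scalar:
  fixes a b c :: real
  assumes E1: "2 * (a * \<sigma> + b * \<tau>) = a^2 * n11 + 2 * a * b * n12 + b^2 * n22"
    and E2: "2 * b * \<sigma> + (c - a) * \<tau> = a * b * n11 + (a * c + b^2) * n12 + b * c * n22"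
    and E3: "2 * (c * \<sigma> - b * \<tau>) = b^2 * n11 + 2 * b * c * n12 + c^2 * n22"
  shows "(\<sigma> * x - \<tau> * y) * (a * x' + b * y') + (\<tau> * x + \<sigma> * y) * (b * x' + c * y')
      + ((a * x + b * y) * (\<sigma> * x' - \<tau> * y') + (b * x + c * y) * (\<tau> * x' + \<sigma> * y')) =
    n11 * ((a * x + b * y) * (a * x' + b * y')) + n12 * ((a * x + b * y) * (b * x' + c * y'))
      + (n12 * ((b * x + c * y) * (a * x' + b * y')) + n22 * ((b * x + c * y) * (b * x' + c * y')))"
proof -
  have "(\<sigma> * x - \<tau> * y) * (a * x' + b * y') + (\<tau> * x + \<sigma> * y) * (b * x' + c * y')
      + ((a * x + b * y) * (\<sigma> * x' - \<tau> * y') + (b * x + c * y) * (\<tau> * x' + \<sigma> * y')) =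
    (2 * (a * \<sigma> + b * \<tau>)) * (x * x') + (2 * b * \<sigma> + (c - a) * \<tau>) * (x * y' + y * x')
      + (2 * (c * \<sigma> - b * \<tau>)) * (y * y')"
    by algebra
  then show ?thesis unfolding E1 E2 E3 by algebra
qed

text \<open>With \<open>T = [u v]\<close> and the symmetric matrix \<open>X\<close> with entries \<open>a, b, c\<close>, the ansatz \<open>W = T X T\<^sup>T\<close>
  turns the quadratic matrix equation for \<open>W\<close> into one for the \<open>2 \<times> 2\<close> matrix \<open>X\<close>, because the
  columns of \<open>T\<close> span an \<open>N\<close>-invariant subspace. The three coefficient equations in the
  hypotheses are that small equation, written out.\<close>

lemma low_rank_riccati:
  fixes N :: "real^'n^'n" and F :: "real^'n^'m" and u v :: "real^'n" and a b c :: real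
  defines "W \<equiv> outer u (a *\<^sub>R u + b *\<^sub>R v) + outer v (b *\<^sub>R u + c *\<^sub>R v)"
    and "n11 \<equiv> (F *v u) \<bullet> (F *v u)" and "n12 \<equiv> (F *v u) \<bullet> (F *v v)"
    and "n22 \<equiv> (F *v v) \<bullet> (F *v v)"
  assumes u: "N *v u = \<sigma> *\<^sub>R u - \<tau> *\<^sub>R v" and v: "N *v v = \<tau> *\<^sub>R u + \<sigma> *\<^sub>R v"
    and E1: "2 * (a * \<sigma> + b * \<tau>) = a^2 * n11 + 2 * a * b * n12 + b^2 * n22"
    and E2: "2 * b * \<sigma> + (c - a) * \<tau> = a * b * n11 + (a * c + b^2) * n12 + b * c * n22"
    and E3: "2 * (c * \<sigma> - b * \<tau>) = b^2 * n11 + 2 * b * c * n12 + c^2 * n22"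
  shows "transpose W = W"
    and "N ** W + W ** transpose N = transpose (F ** W) ** (F ** W)"
    and "x \<bullet> (W *v x) = a * (u \<bullet> x)^2 + 2 * b * (u \<bullet> x) * (v \<bullet> x) + c * (v \<bullet> x)^2"
proof -
  define p q where "p = a *\<^sub>R u + b *\<^sub>R v" and "q = b *\<^sub>R u + c *\<^sub>R v"
  have W: "W = outer u p + outer v q" by (simp add: W_def p_def q_def)
  show sym: "transpose W = W"
    by (simp add: W_def transpose_def outer_def vec_eq_iff algebra_simps)
  have NW: "N ** W = outer (\<sigma> *\<^sub>R u - \<tau> *\<^sub>R v) p + outer (\<tau> *\<^sub>R u + \<sigma> *\<^sub>R v) q"
    by (simp add: W matrix_add_ldistrib matrix_mult_outer u v)
  have "W ** transpose N = transpose (N ** W)"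
    by (simp add: matrix_transpose_mul sym)
  then have WN: "W ** transpose N = outer p (\<sigma> *\<^sub>R u - \<tau> *\<^sub>R v) + outer q (\<tau> *\<^sub>R u + \<sigma> *\<^sub>R v)"
    by (simp add: NW transpose_add transpose_outer)
  have FW: "F ** W = outer (F *v u) p + outer (F *v v) q"
    by (simp add: W matrix_add_ldistrib matrix_mult_outer)
  have "transpose (F ** W) ** (F ** W) =
      (n11 *\<^sub>R outer p p + n12 *\<^sub>R outer p q) + (n12 *\<^sub>R outer q p + n22 *\<^sub>R outer q q)"
    by (simp add: FW transpose_add transpose_outer matrix_add_ldistrib matrix_mul_add_left
        outer_mult_outer n11_def n12_def n22_def inner_commute)
  then show "N ** W + W ** transpose N = transpose (F ** W) ** (F ** W)"
    unfolding NW WN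
    using low_rank_riccati_scalar[OF E1 E2 E3]
    by (simp add: vec_eq_iff outer_def p_def q_def)
  show "x \<bullet> (W *v x) = a * (u \<bullet> x)^2 + 2 * b * (u \<bullet> x) * (v \<bullet> x) + c * (v \<bullet> x)^2"
    by (simp add: W matrix_vector_mult_add_rdistrib outer_mult_vector p_def q_def
        inner_add_left inner_add_right inner_commute algebra_simps power2_eq_square)
qed

text \<open>For invertible \<open>X\<close> the quadratic equation becomes a Lyapunov equation
  \<open>\<Lambda> S + S \<Lambda>\<^sup>T = (n\<^sub>i\<^sub>j)\<close> for \<open>S = X\<^sup>-\<^sup>1\<close>, where \<open>\<Lambda>\<close> has the eigenvalues \<open>\<sigma> \<plusminus> i\<tau>\<close>. It is linear and is
  solved explicitly. Positivity of \<open>S\<close> comes from comparing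
  \<open>s\<^sub>1\<^sub>1 + s\<^sub>2\<^sub>2 = (n\<^sub>1\<^sub>1 + n\<^sub>2\<^sub>2) / 2\<sigma>\<close> with the modulus of
  \<open>s\<^sub>1\<^sub>1 - s\<^sub>2\<^sub>2 + 2i s\<^sub>1\<^sub>2 = (n\<^sub>1\<^sub>1 - n\<^sub>2\<^sub>2 + 2i n\<^sub>1\<^sub>2) / 2(\<sigma> + i\<tau>)\<close>: the second numerator is at most the first in
  modulus by the Cauchy-Schwarz hypothesis, and its denominator is strictly larger as \<open>\<tau> \<noteq> 0\<close>.\<close>

lemma rank_two_coefficients:
  fixes \<sigma> \<tau> n11 n12 n22 :: real
  assumes \<sigma>: "\<sigma> > 0" and \<tau>: "\<tau> \<noteq> 0" and pos: "n11 + n22 > 0" and cs: "n12^2 \<le> n11 * n22"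
  shows "\<exists>a b c. a > 0 \<and> a * c - b^2 > 0 \<and>
    2 * (a * \<sigma> + b * \<tau>) = a^2 * n11 + 2 * a * b * n12 + b^2 * n22 \<and>
    2 * b * \<sigma> + (c - a) * \<tau> = a * b * n11 + (a * c + b^2) * n12 + b * c * n22 \<and>
    2 * (c * \<sigma> - b * \<tau>) = b^2 * n11 + 2 * b * c * n12 + c^2 * n22"
proof -
  define s12 where "s12 = (2 * \<sigma> * n12 - \<tau> * (n11 - n22)) / (4 * (\<sigma>^2 + \<tau>^2))"
  define s11 where "s11 = (n11 / 2 + \<tau> * s12) / \<sigma>"
  define s22 where "s22 = (n22 / 2 - \<tau> * s12) / \<sigma>"
  define d where "d = s11 * s22 - s12^2"
  have m: "\<sigma>^2 + \<tau>^2 > 0" using \<sigma> by (simp add: sum_power2_gt_zero_iff)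
  have N11: "n11 = 2 * (\<sigma> * s11 - \<tau> * s12)" using \<sigma> by (simp add: s11_def)
  have N22: "n22 = 2 * (\<sigma> * s22 + \<tau> * s12)" using \<sigma> by (simp add: s22_def)
  have S12: "4 * (\<sigma>^2 + \<tau>^2) * s12 = 2 * \<sigma> * n12 - \<tau> * (n11 - n22)"
    using m by (simp add: s12_def)
  \<comment> \<open>The values above are the solution of the next three linear equations.\<close>
  have "\<sigma> * (2 * n12) = \<sigma> * (2 * (2 * \<sigma> * s12 + \<tau> * (s11 - s22)))"
    using S12 N11 N22 by algebra
  then have N12: "n12 = 2 * \<sigma> * s12 + \<tau> * (s11 - s22)" using \<sigma> by simp
  have tr: "n11 + n22 = 2 * \<sigma> * (s11 + s22)" using N11 N22 by (simp add: algebra_simps)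
  have "(n11 - n22)^2 + 4 * n12^2 = 4 * ((\<sigma>^2 + \<tau>^2) * ((s11 - s22)^2 + 4 * s12^2))"
    unfolding N11 N12 N22 by algebra
  moreover have "(n11 - n22)^2 + 4 * n12^2 \<le> (n11 + n22)^2"
    using cs by (simp add: power2_eq_square algebra_simps)
  ultimately have "(\<sigma>^2 + \<tau>^2) * ((s11 - s22)^2 + 4 * s12^2) \<le> \<sigma>^2 * (s11 + s22)^2"
    unfolding tr by (simp add: power_mult_distrib)
  moreover have st: "s11 + s22 > 0" using pos \<sigma> unfolding tr by (simp add: zero_less_mult_iff)
  then have "\<tau>^2 * (s11 + s22)^2 > 0" using \<tau> by simp
  ultimately have "(\<sigma>^2 + \<tau>^2) * ((s11 - s22)^2 + 4 * s12^2) < (\<sigma>^2 + \<tau>^2) * (s11 + s22)^2"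
    by (simp add: algebra_simps)
  then have "(s11 - s22)^2 + 4 * s12^2 < (s11 + s22)^2" using m by simp
  then have d: "d > 0" by (simp add: d_def power2_eq_square algebra_simps)
  have "s22 > 0"
  proof (rule ccontr)
    assume "\<not> s22 > 0"
    then have "s11 * s22 \<le> 0" using st by (intro mult_nonneg_nonpos) auto
    then show False using d by (simp add: d_def) (smt (verit) zero_le_power2)
  qed
  define a b c where "a = s22 / d" and "b = - s12 / d" and "c = s11 / d"
  have s: "s22 = a * d" "s12 = - (b * d)" "s11 = c * d"
    using d by (simp_all add: a_def b_def c_def)
  have "d = (a * c - b^2) * d * d"
    using d_def unfolding s by (simp add: power2_eq_square algebra_simps)
  then have inv: "(a * c - b^2) * d = 1" using d by simp
  have "a > 0" using \<open>s22 > 0\<close> d by (simp add: a_def)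
  moreover have "a * c - b^2 > 0" using inv d by (metis zero_less_mult_pos2 zero_less_one)
  moreover have "2 * (a * \<sigma> + b * \<tau>) = a^2 * n11 + 2 * a * b * n12 + b^2 * n22"
    "2 * b * \<sigma> + (c - a) * \<tau> = a * b * n11 + (a * c + b^2) * n12 + b * c * n22"
    "2 * (c * \<sigma> - b * \<tau>) = b^2 * n11 + 2 * b * c * n12 + c^2 * n22"
    using inv unfolding N11 N12 N22 s by algebra+
  ultimately show ?thesis by blast
qed

text \<open>A complex eigenvector \<open>u + iv\<close> for an eigenvalue \<open>\<sigma> + i\<tau>\<close> with \<open>\<sigma> > 0\<close> gives a nonzero positive
  semidefinite \<open>W\<close>: of rank two on the span of \<open>u\<close> and \<open>v\<close> if the eigenvalue is not real, and of
  rank one otherwise.\<close>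

lemma antistable_left_eigenvector_imp_difference:
  fixes N :: "real^'n^'n" and F :: "real^'n^'m" and u v :: "real^'n"
  assumes u: "N *v u = \<sigma> *\<^sub>R u - \<tau> *\<^sub>R v" and v: "N *v v = \<tau> *\<^sub>R u + \<sigma> *\<^sub>R v"
    and \<sigma>: "\<sigma> > 0" and F: "F *v u \<noteq> 0 \<or> F *v v \<noteq> 0"
  shows "\<exists>W x. transpose W = W \<and> N ** W + W ** transpose N = transpose (F ** W) ** (F ** W) \<and>
    x \<bullet> (W *v x) > 0"
proof (cases "\<tau> = 0")
  case True
  obtain w where w: "N *v w = \<sigma> *\<^sub>R w" "F *v w \<noteq> 0"
    using F u v True by (metis add_0 diff_zero scale_zero_left)
  \<comment> \<open>With \<open>b = c = \<tau> = 0\<close> the coefficient equations reduce to \<open>2 a \<sigma> = a\<^sup>2 n\<^sub>1\<^sub>1\<close>.\<close>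
  define a where "a = 2 * \<sigma> / ((F *v w) \<bullet> (F *v w))"
  have a: "a > 0" "2 * \<sigma> = a * ((F *v w) \<bullet> (F *v w))"
    using \<sigma> w(2) by (simp_all add: a_def)
  have Nw: "N *v w = \<sigma> *\<^sub>R w - 0 *\<^sub>R w" "N *v w = 0 *\<^sub>R w + \<sigma> *\<^sub>R w"
    using w(1) by simp_all
  note W = low_rank_riccati[where a=a and b=0 and c=0 and F=F, OF Nw]
  have "w \<bullet> w > 0" using w(2) by auto
  then have pos: "a * (w \<bullet> w)^2 > 0" using a by simp
  show ?thesis
    using W(1,2) W(3)[of w] a(2) pos
    by (intro exI[of _ "outer w (a *\<^sub>R w + 0 *\<^sub>R w) + outer w (0 *\<^sub>R w + 0 *\<^sub>R w)"] exI[of _ w])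
      (simp add: power2_eq_square)
next
  case False
  define n11 n12 n22 where n: "n11 = (F *v u) \<bullet> (F *v u)" "n12 = (F *v u) \<bullet> (F *v v)"
    "n22 = (F *v v) \<bullet> (F *v v)"
  have "n11 + n22 > 0"
    using F unfolding n by (metis add_pos_nonneg add_nonneg_pos inner_ge_zero inner_gt_zero_iff)
  moreover have "n12^2 \<le> n11 * n22"
    unfolding n by (rule Cauchy_Schwarz_ineq)
  ultimately obtain a b c where abc: "a > 0" "a * c - b^2 > 0"
    and E: "2 * (a * \<sigma> + b * \<tau>) = a^2 * n11 + 2 * a * b * n12 + b^2 * n22"
      "2 * b * \<sigma> + (c - a) * \<tau> = a * b * n11 + (a * c + b^2) * n12 + b * c * n22"
      "2 * (c * \<sigma> - b * \<tau>) = b^2 * n11 + 2 * b * c * n12 + c^2 * n22"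
    using rank_two_coefficients[OF \<sigma> False, of n11 n22 n12] by blast
  note W = low_rank_riccati[OF u v E[unfolded n]]
  obtain x where x: "u \<bullet> x \<noteq> 0 \<or> v \<bullet> x \<noteq> 0"
    using F by (metis inner_eq_zero_iff matrix_vector_mult_0_right)
  \<comment> \<open>Completing the square: the form is positive wherever \<open>u \<bullet> x\<close> and \<open>v \<bullet> x\<close> do not both vanish.\<close>
  have "a * (a * (u \<bullet> x)^2 + 2 * b * (u \<bullet> x) * (v \<bullet> x) + c * (v \<bullet> x)^2) =
      (a * (u \<bullet> x) + b * (v \<bullet> x))^2 + (a * c - b^2) * (v \<bullet> x)^2"
    by (simp add: power2_eq_square algebra_simps)
  also have "\<dots> > 0"
  proof (cases "v \<bullet> x = 0")
    case True
    then show ?thesis using x abc(1) by simp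
  next
    case False
    then show ?thesis using abc(2) by (intro add_nonneg_pos) auto
  qed
  finally have "a * (u \<bullet> x)^2 + 2 * b * (u \<bullet> x) * (v \<bullet> x) + c * (v \<bullet> x)^2 > 0"
    using abc(1) by (simp add: zero_less_mult_iff)
  then show ?thesis using W(1,2) W(3)[of x] by metis
qed

section \<open>The closed loop of the minimal Riccati solution\<close>

lemma pos_def_invertible:
  assumes "pos_def M"
  shows "invertible M"
  unfolding invertible_left_inverse matrix_left_invertible_ker
proof (intro allI impI)
  fix x assume "M *v x = 0"
  then show "x = 0" using assms unfolding pos_def_def by (metis inner_zero_right less_irrefl)
qed

lemma transpose_matrix_inv:
  fixes M :: "'a::field^'n^'n"
  assumes "invertible M"
  shows "transpose (matrix_inv M) = matrix_inv (transpose M)"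
proof -
  have "transpose M ** transpose (matrix_inv M) = mat 1"
    using matrix_inv_inverse(2)[OF assms] by (metis matrix_transpose_mul transpose_mat)
  then show ?thesis by (rule matrix_inv_unique[symmetric])
qed

text \<open>As \<open>R\<close> is a symmetric square root of \<open>I - D\<^sup>T D\<close>, the quadratic term is the Gram matrix of
  \<open>L = R\<^sup>-\<^sup>1(B\<^sup>T Y + D\<^sup>T C)\<close>.\<close>

lemma riccati_J_factored:
  assumes R: "pos_def R" "R ** R = mat 1 - transpose D ** D"
  shows "riccati_J A B C D Y \<longleftrightarrow> transpose A ** Y + Y ** A + transpose C ** C
    + transpose (matrix_inv R ** (transpose B ** Y + transpose D ** C))
      ** (matrix_inv R ** (transpose B ** Y + transpose D ** C)) = 0"
proof -
  note i = matrix_inv_inverse[OF pos_def_invertible[OF R(1)]]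
  have "R ** R ** (matrix_inv R ** matrix_inv R) = R ** (R ** matrix_inv R) ** matrix_inv R"
    by (simp only: matrix_mul_assoc)
  then have inv: "matrix_inv (mat 1 - transpose D ** D) = matrix_inv R ** matrix_inv R"
    unfolding R(2)[symmetric] by (intro matrix_inv_unique) (simp add: i)
  have "transpose (matrix_inv R) = matrix_inv R"
    using R(1) transpose_matrix_inv[OF pos_def_invertible[OF R(1)]] by (simp add: pos_def_def)
  then show ?thesis
    unfolding riccati_J_def inv by (simp add: matrix_transpose_mul matrix_mul_assoc)
qed

text \<open>\<open>N\<close> is the transpose of the closed-loop matrix of \<open>Q\<close>. Expanding the Riccati operator around
  its zero \<open>Q\<close> leaves a linear term given by \<open>N\<close> and the quadratic term \<open>(FW)\<^sup>T(FW)\<close>.\<close>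

lemma riccati_difference:
  fixes A :: "real^'n^'n" and F :: "real^'n^'m"
  assumes sym: "transpose W = W"
    and Q: "transpose A ** Q + Q ** A + transpose C ** C + transpose L ** L = 0"
    and N: "N = transpose A + transpose L ** F"
    and W: "N ** W + W ** transpose N = transpose (F ** W) ** (F ** W)"
  shows "transpose A ** (Q - W) + (Q - W) ** A + transpose C ** C
    + transpose (L - F ** W) ** (L - F ** W) = 0"
proof -
  have "transpose A ** (Q - W) + (Q - W) ** A + transpose C ** C
      + transpose (L - F ** W) ** (L - F ** W) =
    (transpose A ** Q + Q ** A + transpose C ** C + transpose L ** L)
      - (N ** W + W ** transpose N) + transpose (F ** W) ** (F ** W)"
    by (simp add: N matrix_ring_simps transpose_add transpose_diff matrix_transpose_mul sym
        matrix_mul_assoc)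
  then show ?thesis by (simp add: Q W)
qed

lemma cmat_eigenvector_Re_Im:
  fixes N :: "real^'n^'n"
  assumes "cmat N *v w = \<mu> *s w"
  defines "u \<equiv> \<chi> i. Re (w $ i)" and "v \<equiv> \<chi> i. Im (w $ i)"
  shows "N *v u = Re \<mu> *\<^sub>R u - Im \<mu> *\<^sub>R v" and "N *v v = Im \<mu> *\<^sub>R u + Re \<mu> *\<^sub>R v"
proof -
  have *: "(\<Sum>j\<in>UNIV. N $ i $ j * w $ j) = \<mu> * w $ i" for i
    using assms(1) by (simp add: vec_eq_iff matrix_vector_mult_def)
  show "N *v u = Re \<mu> *\<^sub>R u - Im \<mu> *\<^sub>R v" "N *v v = Im \<mu> *\<^sub>R u + Re \<mu> *\<^sub>R v"
    using arg_cong[OF *, of Re] arg_cong[OF *, of Im]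
    by (simp_all add: vec_eq_iff matrix_vector_mult_def u_def v_def)
qed

lemma cmat_mult_Re_Im:
  assumes "F *v (\<chi> i. Re (w $ i)) = 0" "F *v (\<chi> i. Im (w $ i)) = 0"
  shows "cmat F *v w = 0"
proof -
  have "(\<Sum>j\<in>UNIV. F $ i $ j * Re (w $ j)) = 0" "(\<Sum>j\<in>UNIV. F $ i $ j * Im (w $ j)) = 0" for i
    using assms by (simp_all add: vec_eq_iff matrix_vector_mult_def)
  then show ?thesis
    by (simp add: vec_eq_iff matrix_vector_mult_def complex_eq_iff)
qed

lemma hurwitz_invertible:
  assumes "hurwitz A" "0 \<le> Re s"
  shows "invertible (mat s - cmat A)"
proof (rule ccontr)
  assume "\<not> invertible (mat s - cmat A)"
  then obtain v where "v \<noteq> 0" "cmat A *v v = s *s v"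
    by (rule not_invertible_imp_eigenvector)
  then show False using assms unfolding hurwitz_def by fastforce
qed

text \<open>An antistable eigenvalue of the closed loop contradicts minimality: the matrix \<open>W\<close> obtained from
  its left eigenvector \<open>w\<close> makes \<open>Q - W\<close> a solution that is not \<open>\<ge> Q\<close>. For \<open>W\<close> to exist, \<open>F w\<close> must
  not vanish; if it did, \<open>w\<close> would be a left eigenvector of \<open>A\<close> itself for an eigenvalue in the
  right half-plane. The bound \<open>Re \<mu> \<le> 0\<close> suffices below, since the antistable summand may have
  poles on the imaginary axis.\<close>

lemma minimal_riccati_solution_closed_loop:
  fixes A :: "real^'n^'n" and B :: "real^'m^'n" and C :: "real^'n^'p" and D :: "real^'m^'p"
  assumes stable: "hurwitz A"
    and R: "pos_def R" "R ** R = mat 1 - transpose D ** D"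
    and Q: "minimal_solution (riccati_J A B C D) Q"
  defines "F \<equiv> matrix_inv R ** transpose B"
    and "L \<equiv> matrix_inv R ** (transpose B ** Q + transpose D ** C)"
  assumes w: "w \<noteq> 0" "cmat (transpose A + transpose L ** F) *v w = \<mu> *s w"
  shows "Re \<mu> \<le> 0"
proof (rule ccontr)
  assume "\<not> Re \<mu> \<le> 0"
  then have \<mu>: "Re \<mu> > 0" by simp
  define N where "N = transpose A + transpose L ** F"
  define u v where "u = (\<chi> i. Re (w $ i))" and "v = (\<chi> i. Im (w $ i))"
  have uv: "N *v u = Re \<mu> *\<^sub>R u - Im \<mu> *\<^sub>R v" "N *v v = Im \<mu> *\<^sub>R u + Re \<mu> *\<^sub>R v"
    unfolding u_def v_def by (intro cmat_eigenvector_Re_Im w(2)[folded N_def])+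
  have "F *v u \<noteq> 0 \<or> F *v v \<noteq> 0"
  proof (rule ccontr)
    assume "\<not> ?thesis"
    then have "cmat F *v w = 0" unfolding u_def v_def by (intro cmat_mult_Re_Im) auto
    then have "cmat (transpose L ** F) *v w = 0"
      by (simp add: cmat_mult matrix_vector_mul_assoc[symmetric])
    then have "transpose (cmat A) *v w = \<mu> *s w"
      using w(2) by (simp add: cmat_hom matrix_vector_mult_add_rdistrib)
    then have "transpose (mat \<mu> - cmat A) *v w = 0"
      by (simp add: transpose_diff matrix_vector_mult_diff_rdistrib mat_mult_scalar)
    moreover have "invertible (transpose (mat \<mu> - cmat A))"
      using hurwitz_invertible[OF stable, of \<mu>] \<mu> by (simp add: invertible_det_nz)
    ultimately show False
      using w(1) unfolding invertible_left_inverse matrix_left_invertible_ker by blast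
  qed
  then obtain W x where W: "transpose W = W" "x \<bullet> (W *v x) > 0"
    "N ** W + W ** transpose N = transpose (F ** W) ** (F ** W)"
    using antistable_left_eigenvector_imp_difference[OF uv \<mu>] by blast
  have Qsym: "transpose Q = Q" and Qeq: "riccati_J A B C D Q"
    and Qmin: "\<And>Y. transpose Y = Y \<Longrightarrow> riccati_J A B C D Y \<Longrightarrow> loewner_le Q Y"
    using Q unfolding minimal_solution_def pos_def_def by blast+
  have L: "L - F ** W = matrix_inv R ** (transpose B ** (Q - W) + transpose D ** C)"
    by (simp add: L_def F_def matrix_ring_simps matrix_mul_assoc)
  have "transpose A ** Q + Q ** A + transpose C ** C + transpose L ** L = 0"
    using Qeq unfolding riccati_J_factored[OF R] L_def .
  from riccati_difference[OF W(1) this N_def W(3)]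
  have "riccati_J A B C D (Q - W)"
    unfolding riccati_J_factored[OF R] L .
  then have "loewner_le Q (Q - W)"
    using Qmin by (simp add: transpose_diff Qsym W(1))
  then have "0 \<le> x \<bullet> ((Q - W - Q) *v x)" unfolding loewner_le_def by blast
  then show False using W(2) unfolding matrix_vector_mult_diff_rdistrib inner_diff_right by simp
qed

section \<open>Block matrices and the spectral factor\<close>

lemma vcat_mult: "vcat M N ** X = vcat (M ** X) (N ** X)"
  by (simp add: vcat_def vec_eq_iff matrix_matrix_mult_def split: sum.split)

lemma mult_hcat: "X ** hcat M N = hcat (X ** M) (X ** N)"
  by (simp add: hcat_def vec_eq_iff matrix_matrix_mult_def split: sum.split)

lemma hcat_mult_vcat: "hcat M N ** vcat X Y = M ** X + N ** Y"
  by (simp add: hcat_def vcat_def vec_eq_iff matrix_matrix_mult_def sum.Plus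
      UNIV_Plus_UNIV[symmetric] del: UNIV_Plus_UNIV)

lemma hcat_minus: "hcat (- M) (- N) = - hcat M N"
  by (simp add: hcat_def vec_eq_iff split: sum.split)

lemma cmat_vcat: "cmat (vcat M N) = vcat (cmat M) (cmat N)"
  by (simp add: vcat_def vec_eq_iff split: sum.split)

lemma cmat_hcat: "cmat (hcat M N) = hcat (cmat M) (cmat N)"
  by (simp add: hcat_def vec_eq_iff split: sum.split)

lemma vcat_add: "vcat M N + vcat M' N' = vcat (M + M') (N + N')"
  by (simp add: vcat_def vec_eq_iff split: sum.split)

lemma hcat_add: "hcat M N + hcat M' N' = hcat (M + M') (N + N')"
  by (simp add: hcat_def vec_eq_iff split: sum.split)

lemma vcat_hcat_one: "vcat (hcat (mat 1) 0) (hcat 0 (mat 1)) = mat 1"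
  by (simp add: vcat_def hcat_def vec_eq_iff mat_def split: sum.split)

text \<open>Block forward substitution.\<close>

lemma lower_triangular_solve:
  fixes J V :: "'a::field^'m^'m" and P :: "'a^'p^'m" and Y1 :: "'a^'k^'p"
  assumes V: "J ** V = mat 1"
  shows "matrix_inv (vcat (hcat (mat 1) 0) (hcat P J)) ** vcat Y1 (P ** Y1 + J ** Y2) = vcat Y1 Y2"
proof -
  define M where "M = vcat (hcat (mat 1 :: 'a^'p^'p) (0 :: 'a^'m^'p)) (hcat P J)"
  have "M ** vcat (hcat (mat 1) 0) (hcat (- (V ** P)) V) = mat 1"
    by (simp add: M_def vcat_mult hcat_mult_vcat mult_hcat matrix_ring_simps matrix_mul_assoc V
        hcat_add vcat_hcat_one)
  then have "invertible M" using invertible_right_inverse by blast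
  then have "matrix_inv M ** (M ** vcat Y1 Y2) = vcat Y1 Y2"
    by (simp add: matrix_mul_assoc matrix_inv_inverse)
  then show ?thesis by (simp add: M_def vcat_mult hcat_mult_vcat matrix_ring_simps)
qed

lemma mat_commute: "mat s ** M = M ** mat (s :: 'a::comm_ring_1)"
  by (simp add: matrix_matrix_mult_def vec_eq_iff mat_def if_distrib if_distribR sum.delta sum.delta'
      mult.commute cong: if_cong)

text \<open>The algebra at a point \<open>s\<close> in which all resolvents exist: \<open>S = s + A\<^sup>T\<close>, \<open>T\<close> is the transposed
  resolvent of \<open>A\<close> at \<open>-s\<close>, \<open>\<Theta>\<close> the resolvent belonging to the closed loop, and
  \<open>Bt T CJt + Rh\<close> is \<open>J(-s)\<^sup>T\<close>.\<close>

context
  fixes S T \<Theta> :: "complex^'n^'n" and Bt F CJ :: "complex^'n^'m" and CJt :: "complex^'m^'n"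
    and Rh Ri :: "complex^'m^'m"
  assumes TS: "T ** S = - mat 1"
    and \<Theta>: "(S - CJt ** F) ** \<Theta> = mat 1"
    and F: "Rh ** F = Bt" and Ri: "Rh ** Ri = mat 1"
begin

text \<open>The second resolvent identity for \<open>T = - S\<^sup>-\<^sup>1\<close> and \<open>\<Theta> = (S - CJt F)\<^sup>-\<^sup>1\<close>.\<close>

lemma closed_loop_resolvent_identity: "T ** CJt ** F ** \<Theta> = - \<Theta> - T"
proof -
  have "T ** ((S - CJt ** F) ** \<Theta>) = T ** S ** \<Theta> - T ** CJt ** F ** \<Theta>"
    by (simp add: matrix_ring_simps matrix_mul_assoc)
  then have "T = - \<Theta> - T ** CJt ** F ** \<Theta>"
    unfolding \<Theta> TS by (simp add: matrix_ring_simps)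
  then show ?thesis by (simp add: algebra_simps)
qed

text \<open>Inverting the spectral factor replaces the poles of \<open>T\<close> by those of \<open>\<Theta>\<close>, that is, the
  negatives of the eigenvalues of \<open>A\<close> by those of the closed loop.\<close>

lemma factor_times_closed_loop: "(Bt ** T ** CJt + Rh) ** (F ** \<Theta>) = - (Bt ** T)"
proof -
  have "(Bt ** T ** CJt + Rh) ** (F ** \<Theta>) = Bt ** (T ** CJt ** F ** \<Theta>) + Rh ** F ** \<Theta>"
    by (simp add: matrix_ring_simps matrix_mul_assoc)
  then show ?thesis
    by (simp add: closed_loop_resolvent_identity F matrix_ring_simps)
qed

text \<open>The state-space formula for the inverse of a transfer function with invertible feedthrough.\<close>

lemma factor_right_inverse: "(Bt ** T ** CJt + Rh) ** (Ri + F ** \<Theta> ** CJt ** Ri) = mat 1"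
proof -
  have "(Bt ** T ** CJt + Rh) ** (Ri + F ** \<Theta> ** CJt ** Ri) =
      Bt ** T ** CJt ** Ri + Rh ** Ri + (Bt ** T ** CJt + Rh) ** (F ** \<Theta>) ** (CJt ** Ri)"
    by (simp add: matrix_ring_simps matrix_mul_assoc)
  then show ?thesis
    unfolding factor_times_closed_loop Ri by (simp add: matrix_ring_simps matrix_mul_assoc)
qed

text \<open>The Riccati equation makes the product of two resolvents split: \<open>A\<^sup>T Q + Q A\<close> equals
  \<open>(s + A\<^sup>T) Q - Q (s - A)\<close>, so that between \<open>T = - (s + A\<^sup>T)\<^sup>-\<^sup>1\<close> and \<open>\<Phi> = (s - A)\<^sup>-\<^sup>1\<close> it leaves a
  term in \<open>\<Phi>\<close> alone and a term in \<open>T\<close> alone. The first is cancelled by the feedthrough of the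
  spectral factor, the second is absorbed by the closed-loop term \<open>F \<Theta> Q\<close>.\<close>

lemma lower_block_identity:
  fixes A Q \<Phi> At :: "complex^'n^'n" and C :: "complex^'n^'p" and Ct :: "complex^'p^'n"
    and Dt :: "complex^'p^'m"
  assumes S: "S = mat s + At" and \<Phi>: "(mat s - A) ** \<Phi> = mat 1"
    and RC: "Rh ** CJ = - (Bt ** Q + Dt ** C)"
    and ric: "Ct ** C + CJt ** CJ = - (At ** Q + Q ** A)"
  shows "Bt ** T ** Ct ** (C ** \<Phi>) + (Bt ** T ** CJt + Rh) ** (CJ ** \<Phi> + F ** \<Theta> ** Q) =
    - (Dt ** (C ** \<Phi>))"
proof -
  have A\<Phi>: "A ** \<Phi> = mat s ** \<Phi> - mat 1"
    using \<Phi> by (simp add: matrix_ring_simps algebra_simps)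
  have TA: "T ** At = - mat 1 - T ** mat s"
    using TS unfolding S by (simp add: matrix_ring_simps algebra_simps)
  have "T ** (Ct ** C + CJt ** CJ) ** \<Phi> = - (T ** At ** Q ** \<Phi>) - T ** Q ** (A ** \<Phi>)"
    unfolding ric by (simp add: matrix_ring_simps matrix_mul_assoc)
  also have "\<dots> = Q ** \<Phi> + T ** (mat s ** Q) ** \<Phi> - T ** Q ** (mat s ** \<Phi>) + T ** Q"
    unfolding A\<Phi> TA by (simp add: matrix_ring_simps matrix_mul_assoc)
  also have "\<dots> = Q ** \<Phi> + T ** Q"
    unfolding mat_commute[of s Q] by (simp add: matrix_mul_assoc)
  finally have key: "T ** (Ct ** C + CJt ** CJ) ** \<Phi> = Q ** \<Phi> + T ** Q" .
  have "Bt ** T ** Ct ** (C ** \<Phi>) + (Bt ** T ** CJt + Rh) ** (CJ ** \<Phi> + F ** \<Theta> ** Q) =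
      Bt ** (T ** (Ct ** C + CJt ** CJ) ** \<Phi>) + Rh ** CJ ** \<Phi>
        + (Bt ** T ** CJt + Rh) ** (F ** \<Theta>) ** Q"
    by (simp add: matrix_ring_simps matrix_mul_assoc)
  also have "\<dots> = - (Dt ** (C ** \<Phi>))"
    unfolding key RC factor_times_closed_loop by (simp add: matrix_ring_simps matrix_mul_assoc)
  finally show ?thesis .
qed

end

section \<open>Partial fractions of the factorization\<close>

lemma strictly_proper_part_eqI:
  fixes F H :: "complex \<Rightarrow> complex^'m^'p"
  assumes "\<And>s. F s = H s + N" "(H \<longlongrightarrow> 0) at_infinity"
  shows "strictly_proper_part F s = H s"
proof -
  have "((\<lambda>s. H s + N) \<longlongrightarrow> 0 + N) at_infinity"
    by (intro tendsto_add assms(2) tendsto_const)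
  moreover have "F = (\<lambda>s. H s + N)" by (rule ext) (rule assms(1))
  ultimately have "(F \<longlongrightarrow> N) at_infinity" by simp
  then have "Lim at_infinity F = N" by (rule tendsto_Lim[OF trivial_limit_at_infinity])
  then show ?thesis by (simp add: strictly_proper_part_def assms(1))
qed

lemma strictly_proper_part_transfer:
  "strictly_proper_part (transfer A B C D) s = cmat C ** resolvent A s ** cmat B"
  by (rule strictly_proper_part_eqI[OF _ realization_tendsto_0]) (simp add: transfer_def)

lemma vcat_transfer:
  "vcat (transfer A B C D s) (transfer A B C' D' s) = transfer A B (vcat C C') (vcat D D') s"
  by (simp add: transfer_def cmat_vcat vcat_mult vcat_add)

lemma hcat_transfer:
  "hcat (transfer A B C D s) (transfer A B' C D' s) = transfer A (hcat B B') C (hcat D D') s"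
  by (simp add: transfer_def cmat_hcat mult_hcat hcat_add)

text \<open>The function whose stable part is sought, already split: the poles of the first summand are
  among the eigenvalues of \<open>A\<close>, those of the second among the negatives of the eigenvalues of the closed loop.\<close>

lemma factorization_residue:
  fixes A :: "real^'n^'n" and B :: "real^'m^'n" and C :: "real^'n^'p" and D :: "real^'m^'p"
    and CJ :: "real^'n^'m" and BX :: "real^'k^'n"
  assumes R: "pos_def R" "R ** R = mat 1 - transpose D ** D"
    and ric: "riccati_J A B C D Q"
    and CJ: "CJ = - (matrix_inv R ** (transpose B ** Q + transpose D ** C))"
    and F: "F = matrix_inv R ** transpose B"
    and N: "N = transpose A - transpose CJ ** F"
    and inv: "invertible (mat s - cmat A)" "invertible (mat (- s) - cmat A)"
      "invertible (mat s - cmat (- N))"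
  defines "X \<equiv> cmat C ** resolvent A s ** cmat BX"
  shows "matrix_inv
      (vcat (hcat (mat 1) 0)
        (hcat (transpose (cmat C ** resolvent A (- s) ** cmat B)) (transpose (transfer A B CJ R (- s)))))
      ** vcat X (- (cmat (transpose D) ** X)) =
    cmat (vcat C CJ) ** resolvent A s ** cmat BX
      + cmat (vcat 0 F) ** resolvent (- N) s ** cmat (Q ** BX)"
proof -
  define S where "S = mat s + transpose (cmat A)"
  define T where "T = transpose (resolvent A (- s))"
  define \<Phi> where "\<Phi> = resolvent A s"
  define \<Theta> where "\<Theta> = resolvent (- N) s"
  have "S = - transpose (mat (- s) - cmat A)"
    by (simp add: S_def vec_eq_iff transpose_def mat_def)
  then have TS: "T ** S = - mat 1"
    using resolvent_inverse(1)[OF inv(2)]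
    by (simp add: T_def matrix_mul_minus_right matrix_transpose_mul[symmetric])
  have \<Phi>: "(mat s - cmat A) ** \<Phi> = mat 1"
    unfolding \<Phi>_def by (rule resolvent_inverse(1)[OF inv(1)])
  have "mat s - cmat (- N) = S - transpose (cmat CJ) ** cmat F"
    by (simp add: S_def N cmat_hom algebra_simps)
  then have \<Theta>: "(S - transpose (cmat CJ) ** cmat F) ** \<Theta> = mat 1"
    using resolvent_inverse(1)[OF inv(3)] by (simp add: \<Theta>_def)
  note i = matrix_inv_inverse(1)[OF pos_def_invertible[OF R(1)]]
  have "cmat (R ** F) = cmat (transpose B)" by (simp add: F matrix_mul_assoc i)
  then have RF: "cmat R ** cmat F = transpose (cmat B)" by (simp add: cmat_hom)
  have "cmat (R ** matrix_inv R) = mat 1" by (simp add: i cmat_one)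
  then have Ri: "cmat R ** cmat (matrix_inv R) = mat 1" by (simp add: cmat_hom)
  have "cmat (R ** CJ) = cmat (- (transpose B ** Q + transpose D ** C))"
    by (simp add: CJ matrix_mul_minus_right matrix_mul_assoc i)
  then have RC: "cmat R ** cmat CJ = - (transpose (cmat B) ** cmat Q + transpose (cmat D) ** cmat C)"
    by (simp add: cmat_hom)
  have "transpose C ** C + transpose CJ ** CJ = - (transpose A ** Q + Q ** A)"
    using minus_unique[OF ric[unfolded riccati_J_factored[OF R] add.assoc[of "transpose A ** Q + Q ** A"]]]
    by (simp add: CJ transpose_minus matrix_mul_minus_left matrix_mul_minus_right)
  from arg_cong[OF this, of cmat]
  have ric': "transpose (cmat C) ** cmat C + transpose (cmat CJ) ** cmat CJ =
      - (transpose (cmat A) ** cmat Q + cmat Q ** cmat A)"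
    by (simp add: cmat_hom)
  have Rt: "transpose (cmat R) = cmat R"
    using R(1) by (simp add: pos_def_def cmat_transpose[symmetric])
  have J: "transpose (transfer A B CJ R (- s)) = transpose (cmat B) ** T ** transpose (cmat CJ) + cmat R"
    by (simp add: transfer_def T_def transpose_add matrix_transpose_mul Rt matrix_mul_assoc)
  have G: "transpose (cmat C ** resolvent A (- s) ** cmat B) = transpose (cmat B) ** T ** transpose (cmat C)"
    by (simp add: T_def matrix_transpose_mul matrix_mul_assoc)
  define Y where "Y = (cmat CJ ** \<Phi> + cmat F ** \<Theta> ** cmat Q) ** cmat BX"
  note low = lower_block_identity[OF TS \<Theta> RF Ri S_def \<Phi> RC ric']
  have "- (cmat (transpose D) ** X) = transpose (cmat B) ** T ** transpose (cmat C) ** X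
      + (transpose (cmat B) ** T ** transpose (cmat CJ) + cmat R) ** Y"
    using arg_cong[OF low, of "\<lambda>M. M ** cmat BX", symmetric]
    by (simp add: X_def Y_def \<Phi>_def cmat_transpose matrix_ring_simps matrix_mul_assoc)
  then have "matrix_inv
      (vcat (hcat (mat 1) 0)
        (hcat (transpose (cmat C ** resolvent A (- s) ** cmat B)) (transpose (transfer A B CJ R (- s)))))
      ** vcat X (- (cmat (transpose D) ** X)) = vcat X Y"
    unfolding J G using lower_triangular_solve[OF factor_right_inverse[OF TS \<Theta> RF Ri]] by simp
  also have "vcat X Y = cmat (vcat C CJ) ** resolvent A s ** cmat BX
      + cmat (vcat 0 F) ** resolvent (- N) s ** cmat (Q ** BX)"
    by (simp add: X_def Y_def \<Phi>_def \<Theta>_def cmat_vcat vcat_mult vcat_add cmat_zero cmat_mult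
        matrix_ring_simps matrix_mul_assoc)
  finally show ?thesis .
qed

theorem theorem4:
  fixes A :: "real^'n^'n" and B :: "real^'m^'n" and C :: "real^'n^'p" and D :: "real^'m^'p"
    and RJ RJh :: "real^'m^'m" and RK RKh :: "real^'p^'p"
    and Q P :: "real^'n^'n"
    and CJ :: "real^'n^'m" and BK :: "real^'p^'n"
    and CY :: "real^'n^('p + 'm)" and BX :: "real^('m + 'p)^'n"
    and G :: "complex \<Rightarrow> complex^'m^'p"
    and J :: "complex \<Rightarrow> complex^'m^'m" and K :: "complex \<Rightarrow> complex^'p^'p"
    and Jhat :: "complex \<Rightarrow> complex^'m^('p + 'm)" and Khat :: "complex \<Rightarrow> complex^('m + 'p)^'p"
    and GA :: "complex \<Rightarrow> complex^('m + 'p)^('p + 'm)"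
    and GB :: "complex \<Rightarrow> complex^'m^('p + 'm)" and GC :: "complex \<Rightarrow> complex^('m + 'p)^'p"
  assumes minimal: "minimal_system A B C"
    and stable: "hurwitz A"
    and G: "G = transfer A B C D"
    and bounded_real:
      "\<forall>\<omega>::real. herm_pos_def (mat 1 - transpose (G (- (\<i> * of_real \<omega>))) ** G (\<i> * of_real \<omega>))"
    and RJ: "RJ = mat 1 - transpose D ** D" and RJ_pos: "pos_def RJ"
    and RK: "RK = mat 1 - D ** transpose D" and RK_pos: "pos_def RK"
    and RJh: "pos_def RJh" "RJh ** RJh = RJ"
    and RKh: "pos_def RKh" "RKh ** RKh = RK"
    and Q: "minimal_solution (riccati_J A B C D) Q"
    and P: "minimal_solution (riccati_K A B C D) P"
    and CJ: "CJ = - (matrix_inv RJh ** (transpose B ** Q + transpose D ** C))"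
    and J: "J = transfer A B CJ RJh"
    and BK: "BK = - ((P ** transpose C + B ** transpose D) ** matrix_inv RKh)"
    and K: "K = transfer A BK C RKh"
    and CY: "CY = vcat C CJ"
    and BX: "BX = hcat B BK"
    and Jhat: "Jhat = (\<lambda>s. vcat (G s) (J s))"
    and Khat: "Khat = (\<lambda>s. hcat (G s) (K s))"
    and GA: "GA = (\<lambda>s. cmat CY ** resolvent A s ** cmat BX)"
    and GB: "GB = (\<lambda>s. cmat CY ** resolvent A s ** cmat B)"
    and GC: "GC = (\<lambda>s. cmat C ** resolvent A s ** cmat BX)"
  shows "\<forall>s. invertible (mat s - cmat A) \<longrightarrow>
      GA s = stable_part
        (\<lambda>s. matrix_inv
               (vcat (hcat (mat 1) 0)
                     (hcat (transpose (strictly_proper_part G (- s))) (transpose (J (- s)))))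
             ** vcat (hcat (strictly_proper_part G s) (strictly_proper_part K s))
                     (hcat (- (cmat (transpose D) ** strictly_proper_part G s))
                           (- (cmat (transpose D) ** strictly_proper_part K s)))) s
    \<and> GB s = strictly_proper_part Jhat s
    \<and> GC s = strictly_proper_part Khat s"
proof -
  define F where "F = matrix_inv RJh ** transpose B"
  define N where "N = transpose A - transpose CJ ** F"
  define H where "H s = cmat CY ** resolvent A s ** cmat BX" for s
  define E where "E s = cmat (vcat (0 :: real^'n^'p) F) ** resolvent (- N) s ** cmat (Q ** BX)" for s
  define \<Psi> where "\<Psi> s = matrix_inv
      (vcat (hcat (mat 1) 0)
            (hcat (transpose (strictly_proper_part G (- s))) (transpose (J (- s)))))
      ** vcat (hcat (strictly_proper_part G s) (strictly_proper_part K s))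
              (hcat (- (cmat (transpose D) ** strictly_proper_part G s))
                    (- (cmat (transpose D) ** strictly_proper_part K s)))" for s
  have root: "RJh ** RJh = mat 1 - transpose D ** D" using RJ RJh(2) by simp
  have stable_pole: "Re z < 0" if "is_pole H z" for z
  proof (rule ccontr)
    assume "\<not> Re z < 0"
    then have "isCont H z"
      unfolding H_def by (intro realization_isCont hurwitz_invertible stable) simp
    then show False using that isCont_not_pole by blast
  qed
  have unstable_pole: "\<not> Re z < 0" if "is_pole E z" for z
  proof
    assume z: "Re z < 0"
    have "invertible (mat z - cmat (- N))"
    proof (rule ccontr)
      assume "\<not> invertible (mat z - cmat (- N))"
      then obtain v where v: "v \<noteq> 0" "cmat (- N) *v v = z *s v"
        by (rule not_invertible_imp_eigenvector)
      have Neq: "N = transpose A + transpose (matrix_inv RJh ** (transpose B ** Q + transpose D ** C))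
          ** (matrix_inv RJh ** transpose B)"
        by (simp add: N_def CJ F_def transpose_minus matrix_mul_minus_left)
      have "cmat N *v v = cmat (- N) *v (- v)"
        by (simp add: vec_eq_iff matrix_vector_mult_def)
      also have "\<dots> = - (cmat (- N) *v v)"
        by (simp add: vec_eq_iff matrix_vector_mult_def sum_negf)
      also have "\<dots> = (- z) *s v" by (simp add: v(2))
      finally have "Re (- z) \<le> 0"
        unfolding Neq by (rule minimal_riccati_solution_closed_loop[OF stable RJh(1) root Q v(1)])
      then show False using z by simp
    qed
    then have "isCont E z" unfolding E_def by (rule realization_isCont)
    then show False using that isCont_not_pole by blast
  qed
  have split: "\<Psi> s = H s + E s"
    if "invertible (mat s - cmat A)" "invertible (mat (- s) - cmat A)"
      "invertible (mat s - cmat (- N))" for s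
  proof -
    have "riccati_J A B C D Q" using Q unfolding minimal_solution_def by blast
    note residue = factorization_residue[OF RJh(1) root this CJ F_def N_def that, of BX]
    show ?thesis
      using residue
      by (simp add: \<Psi>_def H_def E_def G J K CY BX strictly_proper_part_transfer hcat_minus cmat_hcat
          mult_hcat)
  qed
  have "finite {s. \<Psi> s \<noteq> H s + E s}"
  proof (rule finite_subset)
    show "{s. \<Psi> s \<noteq> H s + E s} \<subseteq> {s. \<not> invertible (mat s - cmat A)}
        \<union> uminus ` {s. \<not> invertible (mat s - cmat A)} \<union> {s. \<not> invertible (mat s - cmat (- N))}"
      using split by (force simp: image_iff intro: minus_minus[symmetric])
    show "finite ({s. \<not> invertible (mat s - cmat A)}
        \<union> uminus ` {s. \<not> invertible (mat s - cmat A)} \<union> {s. \<not> invertible (mat s - cmat (- N))})"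
      by (intro finite_UnI finite_imageI finite_spectrum)
  qed
  then have dec: "stable_decomposition \<Psi> H E"
    unfolding stable_decomposition_def
    using stable_pole unstable_pole realization_strictly_proper[of CY A BX]
      realization_strictly_proper[of "vcat (0 :: real^'n^'p) F" "- N" "Q ** BX"]
    by (auto simp: H_def[abs_def] E_def[abs_def])
  show ?thesis
  proof (intro allI impI conjI)
    fix s assume "invertible (mat s - cmat A)"
    then have "isCont H s" unfolding H_def by (rule realization_isCont)
    then show "GA s = stable_part
        (\<lambda>s. matrix_inv
               (vcat (hcat (mat 1) 0)
                     (hcat (transpose (strictly_proper_part G (- s))) (transpose (J (- s)))))
             ** vcat (hcat (strictly_proper_part G s) (strictly_proper_part K s))
                     (hcat (- (cmat (transpose D) ** strictly_proper_part G s))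
                           (- (cmat (transpose D) ** strictly_proper_part K s)))) s"
      using stable_part_eqI[OF dec] by (simp add: GA H_def \<Psi>_def[abs_def])
    show "GB s = strictly_proper_part Jhat s"
      by (simp add: GB Jhat G J CY vcat_transfer strictly_proper_part_transfer)
    show "GC s = strictly_proper_part Khat s"
      by (simp add: GC Khat G K BX hcat_transfer strictly_proper_part_transfer)
  qed
qed

end
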